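(* Let $R$ be an invariant of signed graphs (with values in a field) that is invariant under switching and multiplicative over disjoint unions. Suppose there are constants $\alpha,\beta,\gamma,x,y,z$ with $\gamma\ne0$ such that for every signed graph $\Sigma=(\Gamma=(V,E),\sigma)$ and every positive edge $e\in E$: - $R_\Sigma=\alpha R_{\Sigma/e}+\beta R_{\Sigma\backslash e}$ if $e$ is ordinary in $\Gamma$ and ordinary in $\Sigma$; - $R_\Sigma=\alpha R_{\Sigma/e}+\gamma R_{\Sigma\backslash e}$ if $e$ is ordinary in $\Gamma$ and $k_u(\Sigma\backslash e)<k_u(\Sigma)$; - $R_\Sigma=\alpha R_{\Sigma/e}+\frac{\beta(x-\alpha)}{\gamma}R_{\Sigma\backslash e}$ if $e$ is a bridge of $\Gamma$ and a circuit path edge of $\Sigma$; - $R_\Sigma=xR_{\Sigma/e}$ if $e$ is a bridge of $\Gamma$ that is not a circuit path edge of $\Sigma$; - $R_\Sigma=yR_{\Sigma\backslash e}$ if $e$ is a loop in $\Gamma$ and in $\Sigma$ (i.e. a positive loop); while if $\Sigma$ is a single vertex with $\ell\ge1$ negative loops then $R_\Sigma=\beta^{\ell-1}\gamma+(z-\gamma)\sum_{i=0}^{\ell-1}y^{\ell-1-i}\beta^i$, and $R_\Sigma=1$ when $\Sigma$ is a single vertex with no edges. Then $$R_\Sigma=\alpha^{r_M(E)}\beta^{|E|-r_F(E)}\gamma^{r_F(E)-r_M(E)}T_\Sigma\Big(\frac{x}{\alpha},\frac{y}{\beta},\frac{z}{\gamma}\Big),$$ which is a polynomial in $\alpha,\beta,x,y,z$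 over $\mathbb Z[\gamma,\gamma^{-1}]$; explicitly (and this form is to be used when $\alpha=0$ or $\beta=0$) $$R_\Sigma=\sum_{A\subseteq E}\alpha^{r_M(A)}\beta^{|E|-|A|+r_F(A)-r_F(E)}\gamma^{r_F(E)-r_F(A)-[r_M(E)-r_M(A)]}(x-\alpha)^{r_M(E)-r_M(A)}(y-\beta)^{|A|-r_F(A)}(z-\gamma)^{r_F(A)-r_M(A)}.$$
   Context: A signed graph $\Sigma=(\Gamma,\sigma)$: finite graph $\Gamma=(V,E)$ (loops, multiple edges allowed), $\sigma:E\to\{-1,1\}$. A cycle (loops included) is balanced if the product of its edge signs is $1$, unbalanced otherwise. Switching at a vertex $v$ negates the sign of every non-loop edge incident with $v$. For $A\subseteq E$, $\Sigma\backslash A^c$ is the spanning signed subgraph $(V,A)$. $k,k_b,k_u$: numbers of connected components, balanced components (all cycles balanced), unbalanced components. $r_M(A)=|V|-k(\Sigma\backslash A^c)$ (rank in the cycle matroid $M(\Gamma)$) and $r_F(A)=|V|-k_b(\Sigma\backslash A^c)$ (rank in the signed-graphic matroid $F(\Sigma)$). An element $e$ is a loop of a matroid with rank $r$ if $r(\{e\})=0$, a coloop if $r(E\setminus\{e\})=r(E)-1$, and ordinary otherwise; "ordinary in $\Gamma$" means ordinary in $M(\Gamma)$ (neither a graph loop nor a bridge) and "ordinary in $\Sigma$" means ordinary in $F(\Sigma)$. A bridge of $\Gamma$ is a non-loop edge whose deletion increases $k$. An unbalanced loose handcuff in $\Sigma$ consists of two vertex-disjoint unbalanced cycles joined by a path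 meeting them only at its endpoints; its path edges are circuit path edges of $\Sigma$. $\Sigma\backslash e$ deletes $e$; for a positive non-loop $e$, $\Sigma/e$ contracts $e$ in $\Gamma$ keeping remaining signs; for a positive loop, $\Sigma/e=\Sigma\backslash e$. Signed Tutte polynomial: $$T_\Sigma(X,Y,Z)=\sum_{A\subseteq E}(X-1)^{k(\Sigma\backslash A^c)-k(\Sigma)}(Y-1)^{|A|-|V|+k_b(\Sigma\backslash A^c)}(Z-1)^{k_u(\Sigma\backslash A^c)}.$$ *)

theory Defs
  imports Complex_Main "HOL-Library.Poly_Mapping" "HOL-Library.Infinite_Typeclass"
begin

text \<open>An edge is a loop iff its set of ends is a singleton. The values of \<open>ends\<close> and
  \<open>sign\<close> outside \<open>edges\<close> carry no meaning.\<close>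

record ('v, 'e) sgraph =
  verts :: "'v set"
  edges :: "'e set"
  ends :: "'e \<Rightarrow> 'v set"
  sign :: "'e \<Rightarrow> int"

definition signed_graph :: "('v, 'e) sgraph \<Rightarrow> bool" where
  "signed_graph G \<longleftrightarrow> finite (verts G) \<and> finite (edges G) \<and>
     (\<forall>e\<in>edges G. ends G e \<subseteq> verts G \<and> card (ends G e) \<in> {1, 2} \<and> sign G e \<in> {-1, 1})"

definition graph_loop :: "('v, 'e) sgraph \<Rightarrow> 'e \<Rightarrow> bool" where
  "graph_loop G e \<longleftrightarrow> card (ends G e) = 1"

definition isomorphic :: "('v, 'e) sgraph \<Rightarrow> ('v, 'e) sgraph \<Rightarrow> bool" where
  "isomorphic G H \<longleftrightarrow> (\<exists>f g. bij_betw f (verts G) (verts H) \<and> bij_betw g (edges G) (edges H) \<and>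
     (\<forall>e\<in>edges G. ends H (g e) = f ` ends G e \<and> sign H (g e) = sign G e))"

definition switch :: "'v \<Rightarrow> ('v, 'e) sgraph \<Rightarrow> ('v, 'e) sgraph" where
  "switch v G = G\<lparr>sign := \<lambda>e. if v \<in> ends G e \<and> \<not> graph_loop G e then - sign G e else sign G e\<rparr>"

definition disjoint :: "('v, 'e) sgraph \<Rightarrow> ('v, 'e) sgraph \<Rightarrow> bool" where
  "disjoint G H \<longleftrightarrow> verts G \<inter> verts H = {} \<and> edges G \<inter> edges H = {}"

definition disj_union :: "('v, 'e) sgraph \<Rightarrow> ('v, 'e) sgraph \<Rightarrow> ('v, 'e) sgraph" where
  "disj_union G H =
     \<lparr>verts = verts G \<union> verts H, edges = edges G \<union> edges H,
      ends = (\<lambda>e. if e \<in> edges G then ends G e else ends H e),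
      sign = (\<lambda>e. if e \<in> edges G then sign G e else sign H e)\<rparr>"

definition spanning :: "('v, 'e) sgraph \<Rightarrow> 'e set \<Rightarrow> ('v, 'e) sgraph" where
  "spanning G A = G\<lparr>edges := A\<rparr>"

definition delete :: "('v, 'e) sgraph \<Rightarrow> 'e \<Rightarrow> ('v, 'e) sgraph" where
  "delete G e = spanning G (edges G - {e})"

text \<open>The two ends of a contracted edge are identified with an arbitrarily chosen one of them;
  up to isomorphism the choice is irrelevant. Only meant for positive edges.\<close>

definition merge_ends :: "('v, 'e) sgraph \<Rightarrow> 'e \<Rightarrow> 'v \<Rightarrow> 'v" where
  "merge_ends G e w = (if w \<in> ends G e then (SOME u. u \<in> ends G e) else w)"

definition contract :: "('v, 'e) sgraph \<Rightarrow> 'e \<Rightarrow> ('v, 'e) sgraph" where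
  "contract G e =
     (if graph_loop G e then delete G e
      else \<lparr>verts = merge_ends G e ` verts G, edges = edges G - {e},
            ends = (\<lambda>d. merge_ends G e ` ends G d), sign = sign G\<rparr>)"

text \<open>A cycle is given by its vertices and edges in cyclic order; length 1 is a loop and
  length 2 a pair of parallel edges.\<close>

definition cycle :: "('v, 'e) sgraph \<Rightarrow> 'v list \<Rightarrow> 'e list \<Rightarrow> bool" where
  "cycle G vs es \<longleftrightarrow> es \<noteq> [] \<and> length vs = length es \<and> distinct vs \<and> distinct es \<and>
     set vs \<subseteq> verts G \<and> set es \<subseteq> edges G \<and>
     (\<forall>i<length es. ends G (es ! i) = {vs ! i, vs ! ((i + 1) mod length es)})"

definition balanced_cycle :: "('v, 'e) sgraph \<Rightarrow> 'e list \<Rightarrow> bool" where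
  "balanced_cycle G es \<longleftrightarrow> prod_list (map (sign G) es) = 1"

definition path :: "('v, 'e) sgraph \<Rightarrow> 'v list \<Rightarrow> 'e list \<Rightarrow> bool" where
  "path G vs es \<longleftrightarrow> length vs = length es + 1 \<and> distinct vs \<and>
     set vs \<subseteq> verts G \<and> set es \<subseteq> edges G \<and>
     (\<forall>i<length es. ends G (es ! i) = {vs ! i, vs ! (i + 1)})"

definition adj :: "('v, 'e) sgraph \<Rightarrow> 'v rel" where
  "adj G = {(u, v). \<exists>e\<in>edges G. ends G e = {u, v}}"

text \<open>Connected components are represented by their vertex sets.\<close>

definition components :: "('v, 'e) sgraph \<Rightarrow> 'v set set" where
  "components G = verts G // (adj G)\<^sup>*"

definition balanced_component :: "('v, 'e) sgraph \<Rightarrow> 'v set \<Rightarrow> bool" where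
  "balanced_component G C \<longleftrightarrow>
     (\<forall>vs es. cycle G vs es \<and> set vs \<subseteq> C \<longrightarrow> balanced_cycle G es)"

definition k :: "('v, 'e) sgraph \<Rightarrow> nat" where
  "k G = card (components G)"

definition k\<^sub>b :: "('v, 'e) sgraph \<Rightarrow> nat" where
  "k\<^sub>b G = card {C \<in> components G. balanced_component G C}"

definition k\<^sub>u :: "('v, 'e) sgraph \<Rightarrow> nat" where
  "k\<^sub>u G = card {C \<in> components G. \<not> balanced_component G C}"

definition r\<^sub>M :: "('v, 'e) sgraph \<Rightarrow> 'e set \<Rightarrow> int" where
  "r\<^sub>M G A = int (card (verts G)) - int (k (spanning G A))"

definition r\<^sub>F :: "('v, 'e) sgraph \<Rightarrow> 'e set \<Rightarrow> int" where
  "r\<^sub>F G A = int (card (verts G)) - int (k\<^sub>b (spanning G A))"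

definition matroid_loop :: "('e set \<Rightarrow> int) \<Rightarrow> 'e \<Rightarrow> bool" where
  "matroid_loop r e \<longleftrightarrow> r {e} = 0"

definition matroid_coloop :: "'e set \<Rightarrow> ('e set \<Rightarrow> int) \<Rightarrow> 'e \<Rightarrow> bool" where
  "matroid_coloop E r e \<longleftrightarrow> r (E - {e}) = r E - 1"

definition matroid_ordinary :: "'e set \<Rightarrow> ('e set \<Rightarrow> int) \<Rightarrow> 'e \<Rightarrow> bool" where
  "matroid_ordinary E r e \<longleftrightarrow> \<not> matroid_loop r e \<and> \<not> matroid_coloop E r e"

definition bridge :: "('v, 'e) sgraph \<Rightarrow> 'e \<Rightarrow> bool" where
  "bridge G e \<longleftrightarrow> e \<in> edges G \<and> \<not> graph_loop G e \<and> k G < k (delete G e)"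

definition unbalanced_loose_handcuff ::
  "('v, 'e) sgraph \<Rightarrow> 'v list \<Rightarrow> 'e list \<Rightarrow> 'v list \<Rightarrow> 'e list \<Rightarrow> 'v list \<Rightarrow> 'e list \<Rightarrow> bool" where
  "unbalanced_loose_handcuff G vs es vs' es' ps fs \<longleftrightarrow>
     cycle G vs es \<and> \<not> balanced_cycle G es \<and>
     cycle G vs' es' \<and> \<not> balanced_cycle G es' \<and>
     set vs \<inter> set vs' = {} \<and>
     path G ps fs \<and> set ps \<inter> set vs = {hd ps} \<and> set ps \<inter> set vs' = {last ps}"

definition circuit_path_edge :: "('v, 'e) sgraph \<Rightarrow> 'e \<Rightarrow> bool" where
  "circuit_path_edge G e \<longleftrightarrow>
     (\<exists>vs es vs' es' ps fs. unbalanced_loose_handcuff G vs es vs' es' ps fs \<and> e \<in> set fs)"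

definition signed_tutte :: "('v, 'e) sgraph \<Rightarrow> 'k::field \<Rightarrow> 'k \<Rightarrow> 'k \<Rightarrow> 'k" where
  "signed_tutte G X Y Z =
     (\<Sum>A\<in>Pow (edges G).
        (X - 1) powi (int (k (spanning G A)) - int (k G)) *
        (Y - 1) powi (int (card A) - int (card (verts G)) + int (k\<^sub>b (spanning G A))) *
        (Z - 1) ^ k\<^sub>u (spanning G A))"

text \<open>Elements of \<open>int \<Rightarrow>\<^sub>0 int\<close> are the Laurent polynomials in one variable with integer
  coefficients; an element of \<open>nat \<times> nat \<times> nat \<times> nat \<times> nat \<Rightarrow>\<^sub>0 int \<Rightarrow>\<^sub>0 int\<close> is a polynomial in
  five variables over them, indexed by the exponent vectors of its monomials.\<close>

definition laurent_eval :: "(int \<Rightarrow>\<^sub>0 int) \<Rightarrow> 'k::field \<Rightarrow> 'k" where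
  "laurent_eval c g = (\<Sum>n\<in>Poly_Mapping.keys c. of_int (Poly_Mapping.lookup c n) * g powi n)"

definition poly5_eval ::
  "(nat \<times> nat \<times> nat \<times> nat \<times> nat \<Rightarrow>\<^sub>0 int \<Rightarrow>\<^sub>0 int) \<Rightarrow> 'k::field \<Rightarrow> 'k \<Rightarrow> 'k \<Rightarrow> 'k \<Rightarrow> 'k \<Rightarrow> 'k \<Rightarrow> 'k"
  where
  "poly5_eval p g a b x y z =
     (\<Sum>(i, j, l, m, n)\<in>Poly_Mapping.keys p.
        laurent_eval (Poly_Mapping.lookup p (i, j, l, m, n)) g *
        a ^ i * b ^ j * x ^ l * y ^ m * z ^ n)"

definition scaled_tutte ::
  "('v, 'e) sgraph \<Rightarrow> 'k::field \<Rightarrow> 'k \<Rightarrow> 'k \<Rightarrow> 'k \<Rightarrow> 'k \<Rightarrow> 'k \<Rightarrow> 'k" where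
  "scaled_tutte G a b g x y z =
     a powi r\<^sub>M G (edges G) *
     b powi (int (card (edges G)) - r\<^sub>F G (edges G)) *
     g powi (r\<^sub>F G (edges G) - r\<^sub>M G (edges G)) *
     signed_tutte G (x / a) (y / b) (z / g)"

end

theory Submission
  imports Defs "HOL-Library.FuncSet"
begin

text \<open>
  Let \<open>sols G\<close> be the space of functions \<open>f\<close> on the vertices with values in the field with three
  elements such that \<open>f u = \<sigma>(e) f v\<close> for every edge \<open>e = uv\<close>. Such an \<open>f\<close> vanishes on unbalanced
  components and is determined by one value on each balanced component, so \<open>|sols G| = 3 ^ k\<^sub>b G\<close>;
  making all signs positive turns \<open>k\<^sub>b\<close> into \<open>k\<close>. An edge imposes one linear condition, whence both
  ranks are unit-increase and submodular; contraction and switching act by bijections of solutions.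
  A bridge \<open>e\<close> is a circuit path edge iff \<open>r\<^sub>F E = r\<^sub>F (E - {e})\<close>: both mean that the two sides of \<open>e\<close>
  are unbalanced. Consequently the subset expansion satisfies the recurrences imposed on \<open>R\<close>,
  termwise according to the changes of \<open>r\<^sub>M E\<close> and \<open>r\<^sub>F E\<close> when \<open>e\<close> is deleted, and induction on the
  number of edges reduces the theorem to graphs all of whose edges are negative loops, where the
  expansion factors over the vertices.
\<close>

text \<open>By default the simplifier replaces the field constants by the constructors of the
  three-element type.\<close>

declare zero_finite_3_def [simp del] one_finite_3_def [simp del] two_finite_3 [simp del]

section \<open>Walks, cycles and potentials\<close>

text \<open>The field must separate 1 from -1, which excludes characteristic two, and must be
  finite, so that a dimension can be read off a cardinality. Three elements is the smallest choice,
  and the nonzero ones are then exactly the two signs. The values \<alpha>, \<beta>,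
  \<open>x - \<alpha>\<close>, \<open>y - \<beta>\<close> and \<open>z - \<gamma>\<close> may be 0,
  and for base 0 the law of exponents is safe only for nonnegative exponents. Hence the sum over
  subsets is the object carried through every recurrence, with its exponents shown to be
  nonnegative, and the form with \<open>signed_tutte\<close> is recovered from it by division. Only
  the exponent of \<gamma> can be negative, which is where \<open>\<gamma> \<noteq> 0\<close>
  matters. A negative non-loop becomes positive by switching at one end, but switching never changes
  a loop; this is why negative loops are what remains at the bottom of the induction.\<close>

definition all_positive :: "('v, 'e) sgraph \<Rightarrow> ('v, 'e) sgraph" where
  "all_positive G = G\<lparr>sign := \<lambda>_. 1\<rparr>"

text \<open>Ranging over both orders of the ends avoids orienting the edge; the two conditions agree
  because a sign is its own inverse. A positive loop imposes nothing, a negative loop forces the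
  value 0 at its vertex.\<close>

definition edge_ok :: "('v, 'e) sgraph \<Rightarrow> 'e \<Rightarrow> ('v \<Rightarrow> Enum.finite_3) \<Rightarrow> bool" where
  "edge_ok G e f \<longleftrightarrow> (\<forall>u v. ends G e = {u, v} \<longrightarrow> f u = of_int (sign G e) * f v)"

text \<open>Fixing the value 0 off the vertex set makes total functions stand for functions on the
  vertices, so that the set is finite and can be counted.\<close>

definition sols :: "('v, 'e) sgraph \<Rightarrow> ('v \<Rightarrow> Enum.finite_3) set" where
  "sols G = {f. (\<forall>v. v \<notin> verts G \<longrightarrow> f v = 0) \<and> (\<forall>e\<in>edges G. edge_ok G e f)}"

text \<open>Repetitions are allowed, and the vertices need not lie in \<open>verts G\<close>: a walk
  of length 0 may sit anywhere. Membership of the starting vertex is therefore assumed separately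
  where it matters.\<close>

definition walk :: "('v, 'e) sgraph \<Rightarrow> 'v list \<Rightarrow> 'e list \<Rightarrow> bool" where
  "walk G vs es \<longleftrightarrow> length vs = Suc (length es) \<and> set es \<subseteq> edges G \<and>
     (\<forall>i<length es. ends G (es ! i) = {vs ! i, vs ! Suc i})"

abbreviation sgn_list :: "('v, 'e) sgraph \<Rightarrow> 'e list \<Rightarrow> int" where
  "sgn_list G es \<equiv> prod_list (map (sign G) es)"

lemma finite_3_cases: "x = 0 \<or> x = 1 \<or> x = - 1" for x :: Enum.finite_3
  by (cases x) (simp_all add: zero_finite_3_def one_finite_3_def uminus_finite_3_def)

lemma finite_3_eq_neg: "x = - x \<longleftrightarrow> x = 0" for x :: Enum.finite_3
  by (cases x) (simp_all add: zero_finite_3_def one_finite_3_def uminus_finite_3_def)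

lemma finite_3_card: "card (UNIV :: Enum.finite_3 set) = 3"
  by (simp add: UNIV_finite_3)

lemma ends_cases:
  assumes "signed_graph G" "e \<in> edges G"
  obtains u v where "ends G e = {u, v}" "u \<in> verts G" "v \<in> verts G" "graph_loop G e \<longleftrightarrow> u = v"
proof -
  from assms have "ends G e \<subseteq> verts G" "card (ends G e) = 1 \<or> card (ends G e) = 2"
    by (auto simp: signed_graph_def)
  then show ?thesis using that
    by (auto simp: graph_loop_def card_1_singleton_iff card_2_iff split: if_splits)
qed

lemma sign_cases: "signed_graph G \<Longrightarrow> e \<in> edges G \<Longrightarrow> sign G e = 1 \<or> sign G e = - 1"
  by (auto simp: signed_graph_def)

lemma signed_graph_finite: "signed_graph G \<Longrightarrow> finite (verts G)" "signed_graph G \<Longrightarrow> finite (edges G)"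
  by (auto simp: signed_graph_def)

lemma edge_ok_iff:
  assumes "signed_graph G" "e \<in> edges G" "ends G e = {u, v}"
  shows "edge_ok G e f \<longleftrightarrow> f u = of_int (sign G e) * f v"
  using sign_cases[OF assms(1,2)] assms(3) by (auto simp: edge_ok_def doubleton_eq_iff)

lemma sgn_list_pm:
  assumes "signed_graph G" "set es \<subseteq> edges G"
  shows "sgn_list G es = 1 \<or> sgn_list G es = - 1"
  using assms(2) by (induction es) (auto dest: sign_cases[OF assms(1)])

lemma walk_sub:
  assumes "walk G vs es" "i \<le> j" "j \<le> length es"
  shows "walk G (take (Suc (j - i)) (drop i vs)) (take (j - i) (drop i es))"
  using assms set_take_subset[of "j - i" "drop i es"] set_drop_subset[of i es]
  by (auto simp: walk_def)

lemma walk_append: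
  assumes "walk G vs es" "walk G ws ds" "vs ! length es = ws ! 0"
  shows "walk G (vs @ tl ws) (es @ ds)"
proof -
  have "ends G ((es @ ds) ! i) = {(vs @ tl ws) ! i, (vs @ tl ws) ! Suc i}"
    if i: "i < length (es @ ds)" for i
  proof -
    consider "i < length es" | "i = length es" | j where "i = Suc (length es) + j"
      by (metis less_iff_Suc_add linorder_neqE_nat add_Suc)
    then show ?thesis
      using assms i by cases (auto simp: walk_def nth_append nth_tl Suc_diff_le)
  qed
  then show ?thesis using assms by (auto simp: walk_def)
qed

text \<open>Removes the closed piece between two visits to one vertex. It is the shortening step
  both in extracting a cycle and in choosing a shortest connection between two cycles.\<close>

lemma walk_cut:
  assumes "walk G vs es" "i \<le> j" "j \<le> length es" "vs ! i = vs ! j"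
  shows "walk G (take (Suc i) vs @ drop (Suc j) vs) (take i es @ drop j es)"
proof -
  have len: "length vs = Suc (length es)" using assms by (simp add: walk_def)
  have "walk G (take (Suc i) vs) (take i es)"
    using walk_sub[OF assms(1), of 0 i] assms by simp
  moreover have "walk G (drop j vs) (drop j es)"
    using walk_sub[OF assms(1), of j "length es"] assms len by (simp add: Suc_diff_le)
  ultimately have "walk G (take (Suc i) vs @ tl (drop j vs)) (take i es @ drop j es)"
    by (rule walk_append) (use assms len in \<open>auto simp: min_absorb1\<close>)
  then show ?thesis by (simp add: drop_Suc tl_drop)
qed

lemma walk_rev:
  assumes "walk G vs es"
  shows "walk G (rev vs) (rev es)"
proof -
  have "ends G (rev es ! i) = {rev vs ! i, rev vs ! Suc i}" if "i < length es" for i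
  proof -
    have "Suc (length es - Suc i) = length es - i" using that by simp
    then show ?thesis using assms that by (auto simp: walk_def rev_nth insert_commute)
  qed
  then show ?thesis using assms by (simp add: walk_def)
qed

lemma walk_in_adj:
  assumes "walk G vs es" "i \<le> j" "j \<le> length es"
  shows "(vs ! i, vs ! j) \<in> (adj G)\<^sup>*"
  using assms(2,3)
proof (induction j rule: dec_induct)
  case (step n)
  have "es ! n \<in> edges G" "ends G (es ! n) = {vs ! n, vs ! Suc n}"
    using assms(1) step by (auto simp: walk_def)
  then have "(vs ! n, vs ! Suc n) \<in> adj G" unfolding adj_def by blast
  with step show ?case by auto
qed simp

lemma rtrancl_walk:
  assumes "(u, v) \<in> (adj G)\<^sup>*"
  obtains vs es where "walk G vs es" "vs ! 0 = u" "vs ! length es = v"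
proof -
  have "\<exists>vs es. walk G vs es \<and> vs ! 0 = u \<and> vs ! length es = v" using assms
  proof (induction rule: rtrancl_induct)
    case base
    show ?case by (rule exI[of _ "[u]"], rule exI[of _ "[]"]) (simp add: walk_def)
  next
    case (step v w)
    then obtain vs es where 1: "walk G vs es" "vs ! 0 = u" "vs ! length es = v" by blast
    obtain e where e: "e \<in> edges G" "ends G e = {v, w}" using step(2) by (auto simp: adj_def)
    have "walk G (vs @ tl [v, w]) (es @ [e])"
      by (rule walk_append[OF 1(1)]) (use e 1 in \<open>auto simp: walk_def\<close>)
    moreover have "(vs @ tl [v, w]) ! 0 = u" "(vs @ tl [v, w]) ! length (es @ [e]) = w"
      using 1 by (auto simp: walk_def nth_append)
    ultimately show ?case by blast
  qed
  then show ?thesis using that by blast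
qed

lemma adj_sym: "sym ((adj G)\<^sup>*)"
  by (rule sym_rtrancl) (auto simp: adj_def sym_def insert_commute)

lemma adj_verts:
  assumes "signed_graph G" "(u, v) \<in> (adj G)\<^sup>*" "u \<in> verts G"
  shows "v \<in> verts G"
  using assms(2,3)
  by (induction rule: rtrancl_induct) (use assms(1) in \<open>auto simp: adj_def signed_graph_def\<close>)

lemma edge_ends_adj:
  "e \<in> edges G \<Longrightarrow> ends G e = {u, v} \<Longrightarrow> (u, v) \<in> (adj G)\<^sup>*"
  by (auto simp: adj_def)

text \<open>Strong induction on the length. A repeated vertex splits the closed walk into two
  shorter closed walks whose signs multiply to the sign of the whole, so one of them is again
  negative. Without repetition the walk is itself a cycle.\<close>

lemma negative_closed_walk_cycle:
  assumes G: "signed_graph G"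
    and "walk G vs es" "vs ! 0 = vs ! length es" "sgn_list G es \<noteq> 1" "vs ! 0 \<in> verts G"
  shows "\<exists>cs ds. cycle G cs ds \<and> \<not> balanced_cycle G ds \<and> set cs \<subseteq> (adj G)\<^sup>* `` {vs ! 0}"
  using assms(2-)
proof (induction "length es" arbitrary: vs es rule: less_induct)
  case less
  let ?n = "length es"
  have w: "length vs = Suc ?n" "set es \<subseteq> edges G"
    using less.prems by (auto simp: walk_def)
  have we: "ends G (es ! i) = {vs ! i, vs ! Suc i}" if "i < ?n" for i
    using less.prems that by (auto simp: walk_def)
  have reach: "vs ! i \<in> (adj G)\<^sup>* `` {vs ! 0}" if "i \<le> ?n" for i
    using walk_in_adj[OF less.prems(1), of 0 i] that by simp
  have n0: "?n > 0" using less.prems by auto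
  show ?case
  proof (cases "\<exists>i j. i < j \<and> j < ?n \<and> vs ! i = vs ! j")
    case True
    then obtain i j where ij: "i < j" "j < ?n" "vs ! i = vs ! j" by blast
    let ?es1 = "take (j - i) (drop i es)" and ?vs1 = "take (Suc (j - i)) (drop i vs)"
    let ?es2 = "take i es @ drop j es" and ?vs2 = "take (Suc i) vs @ drop (Suc j) vs"
    have w1: "walk G ?vs1 ?es1" "walk G ?vs2 ?es2"
      using walk_sub[OF less.prems(1), of i j] walk_cut[OF less.prems(1), of i j] ij by auto
    have "es = take i es @ ?es1 @ drop j es"
      using ij by (metis append_take_drop_id drop_drop le_add_diff_inverse2 less_imp_le_nat)
    then have "sgn_list G es = sgn_list G (take i es @ ?es1 @ drop j es)" by simp
    then have "sgn_list G es = sgn_list G ?es1 * sgn_list G ?es2" by simp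
    then consider "sgn_list G ?es1 \<noteq> 1" | "sgn_list G ?es2 \<noteq> 1"
      using less.prems by fastforce
    then show ?thesis
    proof cases
      case 1
      have r: "(vs ! 0, vs ! i) \<in> (adj G)\<^sup>*" using reach[of i] ij by simp
      have e: "?vs1 ! 0 = vs ! i" "?vs1 ! length ?es1 = vs ! j" "length ?es1 < ?n"
        using ij w by (auto simp: min_def)
      have "?vs1 ! 0 = ?vs1 ! length ?es1" by (simp only: e(1,2) ij(3))
      moreover have "?vs1 ! 0 \<in> verts G" unfolding e(1) by (rule adj_verts[OF G r less.prems(4)])
      ultimately have "\<exists>cs ds. cycle G cs ds \<and> \<not> balanced_cycle G ds \<and> set cs \<subseteq> (adj G)\<^sup>* `` {?vs1 ! 0}"
        using less.hyps[OF e(3) w1(1) _ 1] by blast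
      moreover have "(adj G)\<^sup>* `` {vs ! i} \<subseteq> (adj G)\<^sup>* `` {vs ! 0}"
        using r by (auto intro: rtrancl_trans)
      ultimately show ?thesis unfolding e(1) by blast
    next
      case 2
      have e0: "?vs2 ! 0 = vs ! 0" using w by (simp add: nth_append)
      have e1: "?vs2 ! length ?es2 = vs ! ?n" using w ij n0 by (auto simp: nth_append min_def)
      have "length ?es2 < ?n" using ij by auto
      moreover have "?vs2 ! 0 = ?vs2 ! length ?es2" by (simp only: e0 e1 less.prems(2))
      moreover have "?vs2 ! 0 \<in> verts G" by (simp only: e0 less.prems(4))
      ultimately show ?thesis using less.hyps[of ?es2 ?vs2] w1(2) 2 unfolding e0 by blast
    qed
  next
    case False
    have dist: "vs ! i \<noteq> vs ! j" if "i < ?n" "j < ?n" "i \<noteq> j" for i j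
      using False that by (metis linorder_neqE_nat)
    \<comment> \<open>A repeated edge in a closed walk with distinct vertices can only be traversed
      out and straight back, so the walk is that edge twice and its sign is a square.\<close>
    have nodup: "es ! i \<noteq> es ! j" if ij: "i < j" "j < ?n" for i j
    proof
      assume eq: "es ! i = es ! j"
      then have "{vs ! i, vs ! Suc i} = {vs ! j, vs ! Suc j}" using we[of i] we[of j] ij by simp
      then have "vs ! i = vs ! Suc j" "vs ! j = vs ! Suc i"
        using dist[of i j] ij by (auto simp: doubleton_eq_iff)
      then have "j = Suc i" using dist[of j "Suc i"] ij by force
      have "Suc j = ?n" using dist[of i "Suc j"] ij \<open>vs ! i = vs ! Suc j\<close> by force
      then have "vs ! i = vs ! 0" using \<open>vs ! i = vs ! Suc j\<close> less.prems(2) by argo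
      then have "i = 0" using dist[of i 0] ij by (metis gr_zeroI less_trans)
      then obtain a b where ab: "es = [a, b]"
        using \<open>Suc j = ?n\<close> \<open>j = Suc i\<close> by (metis Suc_length_conv length_0_conv)
      then have "a = b" using eq \<open>i = 0\<close> \<open>j = Suc i\<close> by simp
      moreover have "a \<in> edges G" using w ab by simp
      ultimately show False using sign_cases[OF G, of a] less.prems(3) ab by auto
    qed
    have reach': "set (take ?n vs) \<subseteq> (adj G)\<^sup>* `` {vs ! 0}"
    proof
      fix w assume "w \<in> set (take ?n vs)"
      then obtain i where "i < ?n" "w = vs ! i" by (auto simp: in_set_conv_nth)
      then show "w \<in> (adj G)\<^sup>* `` {vs ! 0}" using reach[of i] by simp
    qed
    \<comment> \<open>A cycle lists each vertex once, so the last entry of the walk, equal to the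
      first, is dropped.\<close>
    have "cycle G (take ?n vs) es"
      unfolding cycle_def
    proof (intro conjI allI impI)
      show "es \<noteq> []" using n0 by auto
      show "length (take ?n vs) = ?n" using w by simp
      show "distinct (take ?n vs)" using dist w by (auto simp: distinct_conv_nth)
      show "distinct es" using nodup unfolding distinct_conv_nth by (metis linorder_neqE_nat)
      show "set (take ?n vs) \<subseteq> verts G"
        using reach' adj_verts[OF G _ less.prems(4)] by auto
      show "set es \<subseteq> edges G" by fact
    next
      fix i assume i: "i < ?n"
      show "ends G (es ! i) = {take ?n vs ! i, take ?n vs ! ((i + 1) mod ?n)}"
      proof (cases "Suc i = ?n")
        case True then show ?thesis using we[OF i] i less.prems(2) w n0 by simp
      next
        case False then show ?thesis using we[OF i] i w by simp
      qed
    qed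
    then show ?thesis using reach' less.prems(3) unfolding balanced_cycle_def by blast
  qed
qed

lemma cycle_walk:
  assumes "cycle G vs es"
  shows "walk G (vs @ [vs ! 0]) es"
  using assms unfolding cycle_def walk_def
  by (auto simp: nth_append less_Suc_eq) (metis Suc_lessI mod_less mod_self)+

text \<open>The edge conditions compose along a walk: a solution is transported by the sign of the
  part already traversed.\<close>

lemma walk_sols:
  assumes "signed_graph G" "f \<in> sols G" "walk G vs es" "i \<le> length es"
  shows "f (vs ! 0) = of_int (sgn_list G (take i es)) * f (vs ! i)"
  using assms(4)
proof (induction i)
  case (Suc i)
  have e: "es ! i \<in> edges G" "ends G (es ! i) = {vs ! i, vs ! Suc i}"
    using assms(3) Suc by (auto simp: walk_def)
  have "f (vs ! i) = of_int (sign G (es ! i)) * f (vs ! Suc i)"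
    using assms(2) e edge_ok_iff[OF assms(1) e] by (auto simp: sols_def)
  then show ?case using Suc by (simp add: take_Suc_conv_app_nth mult.assoc)
qed simp

text \<open>Going once around gives \<open>f = - f\<close> at the base vertex, hence 0 because the
  characteristic is not two. The other vertices are reached by walks of sign 1 or -1, which preserve
  the value 0.\<close>

lemma sols_vanish_on_negative_cycle:
  assumes G: "signed_graph G" and f: "f \<in> sols G" and c: "cycle G vs es" "\<not> balanced_cycle G es"
    and v: "v \<in> set vs"
  shows "f v = 0"
proof -
  note w = cycle_walk[OF c(1)]
  have l: "length vs = length es" "es \<noteq> []" "set es \<subseteq> edges G" using c by (auto simp: cycle_def)
  have neg: "sgn_list G es = - 1" using c sgn_list_pm[OF G l(3)] by (auto simp: balanced_cycle_def)
  have "f (vs ! 0) = - f (vs ! 0)"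
    using walk_sols[OF G f w, of "length es"] l neg by (simp add: nth_append split: if_splits)
  then have 0: "f (vs ! 0) = 0" by (simp add: finite_3_eq_neg)
  obtain i where i: "i < length es" "v = vs ! i" using v l by (auto simp: in_set_conv_nth)
  have "0 = of_int (sgn_list G (take i es)) * f v"
    using walk_sols[OF G f w, of i] i l 0 by (simp add: nth_append split: if_splits)
  moreover have "set (take i es) \<subseteq> edges G" using l(3) set_take_subset by fast
  ultimately show ?thesis using sgn_list_pm[OF G, of "take i es"] by auto
qed

lemma sols_vanish_adj:
  assumes "signed_graph G" "f \<in> sols G" "(u, v) \<in> (adj G)\<^sup>*" "f u = 0"
  shows "f v = 0"
proof -
  obtain vs es where w: "walk G vs es" "vs ! 0 = v" "vs ! length es = u"
    using assms(3) adj_sym[of G] rtrancl_walk[of v u G] by (metis symD)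
  then show ?thesis using walk_sols[OF assms(1,2) w(1), of "length es"] assms(4) by simp
qed

lemma component_eq: "C \<in> components G \<Longrightarrow> r \<in> C \<Longrightarrow> C = (adj G)\<^sup>* `` {r}"
  unfolding components_def quotient_def using adj_sym[of G]
  by (auto intro: rtrancl_trans dest: symD)

lemma component_nonempty: "C \<in> components G \<Longrightarrow> \<exists>r\<in>verts G. r \<in> C \<and> C = (adj G)\<^sup>* `` {r}"
  unfolding components_def quotient_def by auto

text \<open>The classical potential of a balanced signed graph: the sign of any walk from a fixed
  root. It is well defined because two walks of different sign to the same vertex would yield an
  unbalanced cycle in the component.\<close>

lemma balanced_potential:
  assumes G: "signed_graph G" and C: "C \<in> components G" and bal: "balanced_component G C"
  obtains s :: "'v \<Rightarrow> int" where "\<And>v. s v = 1 \<or> s v = - 1"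
    "\<And>e u v. e \<in> edges G \<Longrightarrow> ends G e = {u, v} \<Longrightarrow> u \<in> C \<Longrightarrow> s u = sign G e * s v"
proof -
  obtain r where r: "r \<in> verts G" "C = (adj G)\<^sup>* `` {r}" using component_nonempty[OF C] by blast
  let ?W = "\<lambda>v c. \<exists>vs es. walk G vs es \<and> vs ! 0 = r \<and> vs ! length es = v \<and> sgn_list G es = c"
  \<comment> \<open>The value 1 outside \<open>C\<close> is arbitrary; it only keeps
    \<open>s\<close> a sign everywhere.\<close>
  define s where "s v = (if v \<in> C then SOME c. ?W v c else 1)" for v
  have W_s: "?W v (s v)" if "v \<in> C" for v
  proof -
    have "\<exists>c. ?W v c" using that r rtrancl_walk[of r v G] by (metis Image_singleton_iff)
    from someI_ex[OF this] show ?thesis using that unfolding s_def by simp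
  qed
  have pm: "c = 1 \<or> c = - 1" if "?W v c" for v c
    using that sgn_list_pm[OF G] by (auto simp: walk_def)
  have unique: "c = d" if c: "?W v c" and d: "?W v d" for v c d
  proof -
    obtain vs es where 1: "walk G vs es" "vs ! 0 = r" "vs ! length es = v" "sgn_list G es = c"
      using c by blast
    obtain ws ds where 2: "walk G ws ds" "ws ! 0 = r" "ws ! length ds = v" "sgn_list G ds = d"
      using d by blast
    have l: "length vs = Suc (length es)" "length ws = Suc (length ds)" 
      using 1 2 by (auto simp: walk_def)
    \<comment> \<open>Out along one walk and back along the other: a closed walk at the root of sign
      \<open>c * d\<close>.\<close>
    let ?vs = "vs @ tl (rev ws)" and ?es = "es @ rev ds"
    have w: "walk G ?vs ?es"
      by (rule walk_append[OF 1(1) walk_rev[OF 2(1)]]) (use 1 2 l in \<open>simp add: rev_nth\<close>)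
    have e0: "?vs ! 0 = r" using 1 l by (simp add: nth_append)
    have e1: "?vs ! length ?es = r"
      using 1 2 l by (cases "length ds") (auto simp: nth_append nth_tl rev_nth)
    have "sgn_list G (rev ds) = sgn_list G ds" by (induction ds) auto
    then have sg: "sgn_list G ?es = c * d" using 1 2 by simp
    have "c * d = 1"
    proof (rule ccontr)
      assume "c * d \<noteq> 1"
      then have "\<exists>cs ds. cycle G cs ds \<and> \<not> balanced_cycle G ds \<and> set cs \<subseteq> (adj G)\<^sup>* `` {?vs ! 0}"
        by (intro negative_closed_walk_cycle[OF G w]) (use e0 e1 sg r in auto)
      then show False using bal e0 r by (auto simp: balanced_component_def)
    qed
    then show ?thesis using pm[OF c] pm[OF d] by auto
  qed
  show ?thesis
  proof
    show "s v = 1 \<or> s v = - 1" for v using W_s[of v] pm s_def by (cases "v \<in> C") auto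
  next
    fix e u v assume e: "e \<in> edges G" "ends G e = {u, v}" "u \<in> C"
    have v: "v \<in> C" using e r edge_ends_adj[OF e(1,2)] by (auto intro: rtrancl_trans)
    obtain vs es where 1: "walk G vs es" "vs ! 0 = r" "vs ! length es = v" "sgn_list G es = s v"
      using W_s[OF v] by blast
    have "walk G (vs @ tl [v, u]) (es @ [e])"
      by (rule walk_append[OF 1(1)]) (use e 1 in \<open>auto simp: walk_def\<close>)
    moreover have "(vs @ tl [v, u]) ! 0 = r" "(vs @ tl [v, u]) ! length (es @ [e]) = u"
      using 1 by (auto simp: walk_def nth_append)
    moreover have "sgn_list G (es @ [e]) = s v * sign G e" using 1 by simp
    ultimately have "?W u (s v * sign G e)" by blast
    then show "s u = sign G e * s v" using unique[OF W_s[OF e(3)]] by simp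
  qed
qed

section \<open>Ranks by counting solutions over the field with three elements\<close>

lemma card_supported_functions:
  assumes "finite V"
  shows "card {f :: 'a \<Rightarrow> Enum.finite_3. \<forall>v. v \<notin> V \<longrightarrow> f v = 0} = 3 ^ card V"
proof -
  have "bij_betw (\<lambda>f. restrict f V) {f :: 'a \<Rightarrow> Enum.finite_3. \<forall>v. v \<notin> V \<longrightarrow> f v = 0}
    (V \<rightarrow>\<^sub>E UNIV)"
    by (rule bij_betw_byWitness[where f' = "\<lambda>f v. if v \<in> V then f v else 0"])
      (auto simp: fun_eq_iff extensional_def)
  then have "card {f :: 'a \<Rightarrow> Enum.finite_3. \<forall>v. v \<notin> V \<longrightarrow> f v = 0} =
      card (V \<rightarrow>\<^sub>E (UNIV :: Enum.finite_3 set))"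
    by (rule bij_betw_same_card)
  then show ?thesis using assms by (simp add: card_PiE finite_3_card)
qed

lemma components_alt: "components G = (\<lambda>v. (adj G)\<^sup>* `` {v}) ` verts G"
  by (auto simp: components_def quotient_def)

lemma finite_components: "signed_graph G \<Longrightarrow> finite (components G)"
  by (simp add: components_alt signed_graph_finite)

lemma finite_3_pm_square: "c = 1 \<or> c = - 1 \<Longrightarrow> of_int c * (of_int c * y) = (y :: Enum.finite_3)" for c :: int
  by auto

text \<open>The bijection behind the count: a free value on each balanced component is spread over
  the component by its potential, and unbalanced components receive 0.\<close>

lemma card_sols:
  fixes G :: "('v, 'e) sgraph"
  assumes G: "signed_graph G"
  shows "card (sols G) = 3 ^ k\<^sub>b G"
proof -
  define B where "B = {C \<in> components G. balanced_component G C}"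
  define comp where "comp v = (adj G)\<^sup>* `` {v}" for v
  have "\<forall>C\<in>B. \<exists>s :: 'v \<Rightarrow> int. (\<forall>v. s v = 1 \<or> s v = - 1) \<and>
      (\<forall>e u v. e \<in> edges G \<longrightarrow> ends G e = {u, v} \<longrightarrow> u \<in> C \<longrightarrow> s u = sign G e * s v)"
  proof
    fix C assume "C \<in> B"
    then have C: "C \<in> components G" "balanced_component G C" by (auto simp: B_def)
    from balanced_potential[OF G C] show "\<exists>s :: 'v \<Rightarrow> int. (\<forall>v. s v = 1 \<or> s v = - 1) \<and>
      (\<forall>e u v. e \<in> edges G \<longrightarrow> ends G e = {u, v} \<longrightarrow> u \<in> C \<longrightarrow> s u = sign G e * s v)"
      by metis
  qed
  then obtain s :: "'v set \<Rightarrow> 'v \<Rightarrow> int" where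
    s_pm: "\<And>C v. C \<in> B \<Longrightarrow> s C v = 1 \<or> s C v = - 1" and
    s_edge: "\<And>C e u v. C \<in> B \<Longrightarrow> e \<in> edges G \<Longrightarrow> ends G e = {u, v} \<Longrightarrow> u \<in> C \<Longrightarrow>
      s C u = sign G e * s C v"
    by (metis (no_types, lifting) bchoice)
  define rep where "rep C = (SOME v. v \<in> C)" for C :: "'v set"
  have rep: "rep C \<in> C" "rep C \<in> verts G" "comp (rep C) = C" if "C \<in> B" for C
  proof -
    from that obtain r where r: "r \<in> verts G" "r \<in> C" "C = (adj G)\<^sup>* `` {r}"
      using component_nonempty[of C G] by (auto simp: B_def)
    then show 1: "rep C \<in> C" unfolding rep_def by (metis someI)
    then show "rep C \<in> verts G" using r adj_verts[OF G] by auto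
    show "comp (rep C) = C" using 1 that component_eq[of C G] by (auto simp: B_def comp_def)
  qed
  define \<Phi> where "\<Phi> g v = (if v \<in> verts G \<and> comp v \<in> B then of_int (s (comp v) v) * g (comp v) else 0)"
    for g :: "'v set \<Rightarrow> Enum.finite_3" and v
  \<comment> \<open>The potential at the representative may be -1; multiplying by it once more
    undoes it, since a sign is its own inverse.\<close>
  define \<Psi> where "\<Psi> f C = (if C \<in> B then of_int (s C (rep C)) * f (rep C) else 0)"
    for f :: "'v \<Rightarrow> Enum.finite_3" and C
  \<comment> \<open>On a balanced component a solution times the potential is constant, so one value
    determines the solution there.\<close>
  have invariant: "of_int (s C u) * f u = of_int (s C v) * f v"
    if f: "f \<in> sols G" and C: "C \<in> B" "u \<in> C" and uv: "(u, v) \<in> (adj G)\<^sup>*" for f u v C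
    using uv
  proof (induction rule: rtrancl_induct)
    case (step a b)
    obtain e where e: "e \<in> edges G" "ends G e = {a, b}" using step(2) by (auto simp: adj_def)
    have "a \<in> C" using step(1) C component_eq[of C G u] by (auto simp: B_def)
    then have "s C a = sign G e * s C b" using s_edge C e by blast
    moreover have "f a = of_int (sign G e) * f b"
      using f e edge_ok_iff[OF G e] by (auto simp: sols_def)
    ultimately show ?case using step sign_cases[OF G e(1)] by auto
  qed simp
  have \<Phi>: "\<Phi> g \<in> sols G" for g
  proof -
    have "edge_ok G e (\<Phi> g)" if e: "e \<in> edges G" for e
    proof -
      obtain u v where uv: "ends G e = {u, v}" "u \<in> verts G" "v \<in> verts G"
        using ends_cases[OF G e] by metis
      have a: "(u, v) \<in> (adj G)\<^sup>*" using edge_ends_adj e uv by metis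
      have "comp u \<in> components G" using uv by (auto simp: comp_def components_alt)
      then have "comp v = comp u"
        using component_eq[of "comp u" G v] a by (auto simp: comp_def)
      moreover have "s (comp u) u = sign G e * s (comp u) v" if "comp u \<in> B"
        using s_edge[OF that e uv(1)] by (auto simp: comp_def)
      ultimately show ?thesis
        unfolding edge_ok_iff[OF G e uv(1)] using uv by (auto simp: \<Phi>_def)
    qed
    then show ?thesis by (auto simp: sols_def \<Phi>_def)
  qed
  have \<Phi>\<Psi>: "\<Phi> (\<Psi> f) = f" if f: "f \<in> sols G" for f
  proof
    fix v
    consider "v \<notin> verts G" | "v \<in> verts G" "comp v \<in> B" | "v \<in> verts G" "comp v \<notin> B" by blast
    then show "\<Phi> (\<Psi> f) v = f v"
    proof cases
      case 1 then show ?thesis using f by (auto simp: \<Phi>_def sols_def)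
    next
      case 2
      have v: "v \<in> comp v" by (simp add: comp_def)
      have r: "(v, rep (comp v)) \<in> (adj G)\<^sup>*" using rep(1)[OF 2(2)] by (simp add: comp_def)
      show ?thesis
        using invariant[OF f 2(2) v r] s_pm[OF 2(2)] 2
        by (simp add: \<Phi>_def \<Psi>_def) (metis finite_3_pm_square)
    next
      case 3
      \<comment> \<open>The zero on an unbalanced cycle spreads through the whole component.\<close>
      then have "\<not> balanced_component G (comp v)" by (auto simp: B_def comp_def components_alt)
      then obtain cs ds where c: "cycle G cs ds" "\<not> balanced_cycle G ds" "set cs \<subseteq> comp v"
        by (auto simp: balanced_component_def)
      have "cs ! 0 \<in> set cs" using c by (auto simp: cycle_def)
      then have "f (cs ! 0) = 0" "(v, cs ! 0) \<in> (adj G)\<^sup>*"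
        using sols_vanish_on_negative_cycle[OF G f c(1,2)] c(3) by (auto simp: comp_def)
      then have "f v = 0" using sols_vanish_adj[OF G f] adj_sym[of G] by (metis symD)
      then show ?thesis using 3 by (simp add: \<Phi>_def)
    qed
  qed
  have \<Psi>\<Phi>: "\<Psi> (\<Phi> g) = g" if g: "\<forall>C. C \<notin> B \<longrightarrow> g C = 0" for g
  proof
    fix C
    show "\<Psi> (\<Phi> g) C = g C"
      using g rep[of C] s_pm[of C "rep C"] by (auto simp: \<Phi>_def \<Psi>_def)
  qed
  have "bij_betw \<Phi> {g. \<forall>C. C \<notin> B \<longrightarrow> g C = 0} (sols G)"
    by (rule bij_betw_byWitness[where f' = \<Psi>]) (use \<Phi> \<Phi>\<Psi> \<Psi>\<Phi> in \<open>auto simp: \<Psi>_def\<close>)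
  then have "card (sols G) = card {g :: 'v set \<Rightarrow> Enum.finite_3. \<forall>C. C \<notin> B \<longrightarrow> g C = 0}"
    by (rule bij_betw_same_card[symmetric])
  also have "\<dots> = 3 ^ card B"
    by (rule card_supported_functions) (simp add: B_def finite_components[OF G])
  finally show ?thesis by (simp add: k\<^sub>b_def B_def)
qed

lemma k\<^sub>b_eqI:
  "signed_graph G \<Longrightarrow> signed_graph H \<Longrightarrow> bij_betw F (sols G) (sols H) \<Longrightarrow> k\<^sub>b G = k\<^sub>b H"
  using card_sols[of G] card_sols[of H] bij_betw_same_card[of F "sols G" "sols H"] by simp

text \<open>The potential, extended by 0, is a solution. Used contrapositively: if all solutions
  vanish at a vertex, its component contains an unbalanced cycle.\<close>

lemma balanced_component_nonvanishing:
  assumes G: "signed_graph G" and C: "C \<in> components G" "balanced_component G C" "u \<in> C"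
  shows "\<exists>f\<in>sols G. f u \<noteq> 0"
proof -
  obtain s where s: "\<And>v. s v = 1 \<or> s v = - 1"
    "\<And>e u v. e \<in> edges G \<Longrightarrow> ends G e = {u, v} \<Longrightarrow> u \<in> C \<Longrightarrow> s u = sign G e * s v"
    using balanced_potential[OF G C(1,2)] by blast
  define f :: "_ \<Rightarrow> Enum.finite_3" where "f v = (if v \<in> C then of_int (s v) else 0)" for v
  have CG: "C \<subseteq> verts G" using component_nonempty[OF C(1)] adj_verts[OF G] by auto
  have "edge_ok G e f" if e: "e \<in> edges G" for e
  proof -
    obtain u v where uv: "ends G e = {u, v}" using ends_cases[OF G e] by metis
    have a: "(u, v) \<in> (adj G)\<^sup>*" "(v, u) \<in> (adj G)\<^sup>*"
      using edge_ends_adj e uv insert_commute by metis+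
    then have "u \<in> C \<longleftrightarrow> v \<in> C" using component_eq[OF C(1)] by blast
    then show ?thesis unfolding edge_ok_iff[OF G e uv] using s(2)[OF e uv] by (auto simp: f_def)
  qed
  then have "f \<in> sols G" using CG by (auto simp: sols_def f_def)
  moreover have "f u \<noteq> 0" using C s(1)[of u] by (auto simp: f_def)
  ultimately show ?thesis by blast
qed

section \<open>The effect of one additional edge on the solution space\<close>

lemma spanning_simps [simp]:
  "verts (spanning G A) = verts G" "edges (spanning G A) = A"
  "ends (spanning G A) = ends G" "sign (spanning G A) = sign G"
  "spanning (spanning G A) B = spanning G B" "spanning G (edges G) = G"
  by (simp_all add: spanning_def)

lemma signed_graph_spanning: "signed_graph G \<Longrightarrow> A \<subseteq> edges G \<Longrightarrow> signed_graph (spanning G A)"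
  by (auto simp: signed_graph_def intro: finite_subset)

lemma edge_ok_spanning [simp]: "edge_ok (spanning G A) = edge_ok G"
  by (simp add: edge_ok_def fun_eq_iff)

text \<open>The new edge restricts the solutions to the kernel of one linear functional
  \<open>L\<close>. Either \<open>L\<close> is zero on the old solutions and nothing changes, or the
  kernel has index 3 and one balanced component is lost.\<close>

lemma k\<^sub>b_insert:
  assumes G: "signed_graph G" and A: "A \<subseteq> edges G" and e: "e \<in> edges G"
  shows "k\<^sub>b (spanning G A) = k\<^sub>b (spanning G (insert e A)) +
    (if \<forall>f\<in>sols (spanning G A). edge_ok G e f then 0 else 1)"
proof -
  let ?S = "sols (spanning G A)" and ?T = "sols (spanning G (insert e A))"
  have sg: "signed_graph (spanning G A)" "signed_graph (spanning G (insert e A))"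
    using signed_graph_spanning[OF G] A e by auto
  have T: "?T = {f \<in> ?S. edge_ok G e f}" by (auto simp: sols_def)
  show ?thesis
  proof (cases "\<forall>f\<in>?S. edge_ok G e f")
    case True
    then have "?T = ?S" using T by auto
    then show ?thesis using True card_sols[OF sg(1)] card_sols[OF sg(2)] by simp
  next
    case False
    obtain u v where uv: "ends G e = {u, v}" using ends_cases[OF G e] by metis
    define L where "L f = f u - of_int (sign G e) * f v" for f :: "_ \<Rightarrow> Enum.finite_3"
    have ok: "edge_ok G e f \<longleftrightarrow> L f = 0" for f
      unfolding edge_ok_iff[OF G e uv] L_def by simp
    have lin: "(\<lambda>w. f w + c * g w) \<in> ?S" if "f \<in> ?S" "g \<in> ?S" for f g c
    proof -
      have "edge_ok G d (\<lambda>w. f w + c * g w)" if "edge_ok G d f" "edge_ok G d g" for d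
        unfolding edge_ok_def
      proof (intro allI impI)
        fix a b assume "ends G d = {a, b}"
        then have "f a = of_int (sign G d) * f b" "g a = of_int (sign G d) * g b"
          using that by (auto simp: edge_ok_def)
        then show "f a + c * g a = of_int (sign G d) * (f b + c * g b)"
          by (simp add: algebra_simps)
      qed
      then show ?thesis using that by (auto simp: sols_def)
    qed
    have L_lin: "L (\<lambda>w. f w + c * g w) = L f + c * L g" for f g c
      by (simp add: L_def algebra_simps)
    have 0: "(\<lambda>_. 0) \<in> ?S" by (simp add: sols_def edge_ok_def)
    \<comment> \<open>Scaling \<open>f\<close> by \<open>L f\<close> normalises the functional,
      because a nonzero element of the field squares to 1.\<close>
    obtain h where h: "h \<in> ?S" "L h = 1"
    proof -
      obtain f where f: "f \<in> ?S" "L f \<noteq> 0" using False ok by blast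
      have "(\<lambda>w. 0 + L f * f w) \<in> ?S" by (rule lin[OF 0 f(1)])
      moreover have "L (\<lambda>w. 0 + L f * f w) = 1"
        unfolding L_lin using f(2) finite_3_cases[of "L f"] by (auto simp: L_def)
      ultimately show ?thesis using that by blast
    qed
    \<comment> \<open>Every old solution is uniquely an element of the kernel plus a multiple of
      \<open>h\<close>, the multiple being its value under \<open>L\<close>.\<close>
    have "bij_betw (\<lambda>(f, c). (\<lambda>w. f w + c * h w)) (?T \<times> UNIV) ?S"
      by (rule bij_betw_byWitness[where f' = "\<lambda>f. (\<lambda>w. f w + (- L f) * h w, L f)"])
        (use lin h in \<open>auto simp: T ok L_lin fun_eq_iff simp del: mult_minus_left\<close>, auto)
    then have "card ?S = 3 * card ?T"
      using bij_betw_same_card by (fastforce simp: card_cartesian_product finite_3_card)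
    then have "(3::nat) ^ k\<^sub>b (spanning G A) = 3 ^ Suc (k\<^sub>b (spanning G (insert e A)))"
      using card_sols[OF sg(1)] card_sols[OF sg(2)] by simp
    then have "k\<^sub>b (spanning G A) = Suc (k\<^sub>b (spanning G (insert e A)))"
      by (subst (asm) power_inject_exp) auto
    then show ?thesis by (simp only: False if_False)
  qed
qed

lemma r\<^sub>F_empty:
  assumes "signed_graph G"
  shows "r\<^sub>F G {} = 0"
proof -
  have "sols (spanning G {}) = {f. \<forall>v. v \<notin> verts G \<longrightarrow> f v = 0}" by (auto simp: sols_def)
  then have "(3::nat) ^ k\<^sub>b (spanning G {}) = 3 ^ card (verts G)"
    using card_sols[of "spanning G {}"] signed_graph_spanning[of G "{}"] assms
      card_supported_functions[of "verts G"] by (simp add: signed_graph_finite)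
  then show ?thesis by (simp add: r\<^sub>F_def)
qed

lemma r\<^sub>F_insert:
  assumes "signed_graph G" "A \<subseteq> edges G" "e \<in> edges G"
  shows "r\<^sub>F G (insert e A) = r\<^sub>F G A + (if \<forall>f\<in>sols (spanning G A). edge_ok G e f then 0 else 1)"
  using k\<^sub>b_insert[OF assms] by (auto simp: r\<^sub>F_def)

lemma r\<^sub>F_insert_cases:
  assumes "signed_graph G" "A \<subseteq> edges G" "e \<in> edges G"
  shows "r\<^sub>F G (insert e A) = r\<^sub>F G A \<or> r\<^sub>F G (insert e A) = r\<^sub>F G A + 1"
  using r\<^sub>F_insert[OF assms] by auto

text \<open>Fewer edges leave more solutions, so a condition violated over \<open>B\<close> is
  violated over \<open>A\<close>. This is the form in which submodularity is used: a coloop of the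
  whole edge set raises the rank of every set avoiding it.\<close>

lemma r\<^sub>F_insert_mono:
  assumes "signed_graph G" "A \<subseteq> B" "B \<subseteq> edges G" "e \<in> edges G" "r\<^sub>F G (insert e B) = r\<^sub>F G B + 1"
  shows "r\<^sub>F G (insert e A) = r\<^sub>F G A + 1"
proof -
  have "sols (spanning G B) \<subseteq> sols (spanning G A)" using assms(2) by (auto simp: sols_def)
  then show ?thesis
    using r\<^sub>F_insert[of G A e] r\<^sub>F_insert[of G B e] assms by (auto split: if_splits)
qed

text \<open>Each added edge raises the rank by 0 or 1. These two inequalities are the source of the
  nonnegative exponents in the expansion.\<close>

lemma r\<^sub>F_bounds:
  assumes "signed_graph G" "A \<subseteq> B" "B \<subseteq> edges G"
  shows "r\<^sub>F G A \<le> r\<^sub>F G B \<and> r\<^sub>F G B \<le> r\<^sub>F G A + int (card B) - int (card A)"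
proof -
  have "finite B" using assms signed_graph_finite finite_subset by metis
  then show ?thesis using assms(2,3)
  proof (induction "B - A" arbitrary: B rule: infinite_finite_induct)
    case infinite then show ?case by simp
  next
    case empty then have "B = A" by auto then show ?case by simp
  next
    case (insert e F)
    let ?B = "B - {e}"
    have e: "e \<in> B" "e \<notin> A" using insert by auto
    have "r\<^sub>F G A \<le> r\<^sub>F G ?B \<and> r\<^sub>F G ?B \<le> r\<^sub>F G A + int (card ?B) - int (card A)"
      by (rule insert(3)) (use insert e in auto)
    moreover have "card B = Suc (card ?B)"
      using e insert by (metis card_Suc_Diff1)
    moreover have "r\<^sub>F G B = r\<^sub>F G ?B \<or> r\<^sub>F G B = r\<^sub>F G ?B + 1"
      using r\<^sub>F_insert_cases[OF assms(1), of ?B e] insert e by (auto simp: insert_absorb)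
    ultimately show ?case by auto
  qed
qed

section \<open>The cycle matroid as the case of positive signs\<close>

lemma all_positive_simps [simp]:
  "verts (all_positive G) = verts G" "edges (all_positive G) = edges G"
  "ends (all_positive G) = ends G" "sign (all_positive G) e = 1"
  "graph_loop (all_positive G) = graph_loop G"
  "spanning (all_positive G) A = all_positive (spanning G A)"
  "delete (all_positive G) e = all_positive (delete G e)"
  by (simp_all add: all_positive_def spanning_def delete_def graph_loop_def fun_eq_iff)

lemma signed_graph_all_positive: "signed_graph G \<Longrightarrow> signed_graph (all_positive G)"
  by (auto simp: signed_graph_def)

lemma k_all_positive: "k G = k\<^sub>b (all_positive G)"
proof -
  have "prod_list (map (sign (all_positive G)) es) = 1" for es by (induction es) auto
  then have "balanced_component (all_positive G) C" for C
    by (simp add: balanced_component_def balanced_cycle_def)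
  moreover have "components (all_positive G) = components G" by (simp add: components_def adj_def)
  ultimately show ?thesis by (simp add: k_def k\<^sub>b_def)
qed

lemma r\<^sub>M_all_positive: "r\<^sub>M G = r\<^sub>F (all_positive G)"
  by (simp add: fun_eq_iff r\<^sub>M_def r\<^sub>F_def k_all_positive)

lemma r\<^sub>M_empty: "signed_graph G \<Longrightarrow> r\<^sub>M G {} = 0"
  by (simp add: r\<^sub>M_all_positive r\<^sub>F_empty signed_graph_all_positive)

lemma r\<^sub>M_insert_cases:
  assumes "signed_graph G" "A \<subseteq> edges G" "e \<in> edges G"
  shows "r\<^sub>M G (insert e A) = r\<^sub>M G A \<or> r\<^sub>M G (insert e A) = r\<^sub>M G A + 1"
  using r\<^sub>F_insert_cases[OF signed_graph_all_positive] assms by (simp add: r\<^sub>M_all_positive)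

lemma r\<^sub>M_insert_mono:
  assumes "signed_graph G" "A \<subseteq> B" "B \<subseteq> edges G" "e \<in> edges G" "r\<^sub>M G (insert e B) = r\<^sub>M G B + 1"
  shows "r\<^sub>M G (insert e A) = r\<^sub>M G A + 1"
  using r\<^sub>F_insert_mono[OF signed_graph_all_positive] assms by (simp add: r\<^sub>M_all_positive)

lemma r\<^sub>M_bounds:
  assumes "signed_graph G" "A \<subseteq> B" "B \<subseteq> edges G"
  shows "r\<^sub>M G A \<le> r\<^sub>M G B \<and> r\<^sub>M G B \<le> r\<^sub>M G A + int (card B) - int (card A)"
  using r\<^sub>F_bounds[OF signed_graph_all_positive] assms by (simp add: r\<^sub>M_all_positive)

lemma k_eq_k\<^sub>b_plus_k\<^sub>u:
  assumes "signed_graph G"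
  shows "k G = k\<^sub>b G + k\<^sub>u G"
proof -
  have "components G = {C \<in> components G. balanced_component G C} \<union>
      {C \<in> components G. \<not> balanced_component G C}" by auto
  then have "card (components G) = card \<dots>" by simp
  also have "\<dots> = k\<^sub>b G + k\<^sub>u G" unfolding k\<^sub>b_def k\<^sub>u_def
    using finite_components[OF assms] by (intro card_Un_disjoint) auto
  finally show ?thesis by (simp add: k_def)
qed

text \<open>The number of vertices cancels in the difference of the ranks. This translates the
  condition on unbalanced components in the recurrences, and the exponent of \<open>Z - 1\<close>,
  into ranks.\<close>

lemma k\<^sub>u_spanning:
  "signed_graph G \<Longrightarrow> A \<subseteq> edges G \<Longrightarrow> int (k\<^sub>u (spanning G A)) = r\<^sub>F G A - r\<^sub>M G A"
  using k_eq_k\<^sub>b_plus_k\<^sub>u[OF signed_graph_spanning, of G A] by (simp add: r\<^sub>F_def r\<^sub>M_def)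

lemma r\<^sub>M_le_r\<^sub>F: "signed_graph G \<Longrightarrow> A \<subseteq> edges G \<Longrightarrow> r\<^sub>M G A \<le> r\<^sub>F G A"
  using k\<^sub>u_spanning[of G A] by linarith

lemma r\<^sub>F_positive_loop:
  assumes G: "signed_graph G" "A \<subseteq> edges G" "e \<in> edges G" "graph_loop G e" "sign G e = 1"
  shows "r\<^sub>F G (insert e A) = r\<^sub>F G A"
proof -
  have "edge_ok G e f" for f
    using assms by (auto simp: edge_ok_def graph_loop_def card_1_singleton_iff)
  then show ?thesis using r\<^sub>F_insert[OF G(1-3)] by simp
qed

lemma r\<^sub>M_loop:
  assumes "signed_graph G" "A \<subseteq> edges G" "e \<in> edges G" "graph_loop G e"
  shows "r\<^sub>M G (insert e A) = r\<^sub>M G A"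
  using r\<^sub>F_positive_loop[OF signed_graph_all_positive[OF assms(1)], of A e] assms
  by (simp add: r\<^sub>M_all_positive)

lemma r\<^sub>F_nonloop:
  assumes G: "signed_graph G" and e: "e \<in> edges G" "\<not> graph_loop G e"
  shows "r\<^sub>F G {e} = 1"
proof -
  obtain u v where uv: "ends G e = {u, v}" "u \<in> verts G" "u \<noteq> v" using ends_cases[OF G e(1)] e by metis
  \<comment> \<open>The indicator of one end satisfies every condition of the edgeless graph but
    violates that of \<open>e\<close>.\<close>
  define f where "f w = (if w = u then 1 else 0 :: Enum.finite_3)" for w
  have "f \<in> sols (spanning G {})" using uv by (auto simp: sols_def f_def)
  moreover have "\<not> edge_ok G e f" unfolding edge_ok_iff[OF G e(1) uv(1)] using uv by (simp add: f_def)
  ultimately have "\<not> (\<forall>f\<in>sols (spanning G {}). edge_ok G e f)" by blast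
  then show ?thesis using r\<^sub>F_insert[OF G, of "{}" e] e r\<^sub>F_empty[OF G] by simp
qed

lemma r\<^sub>M_nonloop: "signed_graph G \<Longrightarrow> e \<in> edges G \<Longrightarrow> \<not> graph_loop G e \<Longrightarrow> r\<^sub>M G {e} = 1"
  using r\<^sub>F_nonloop[OF signed_graph_all_positive, of G e] by (simp add: r\<^sub>M_all_positive)

section \<open>Contraction of a positive edge\<close>

lemma merge_ends_simps:
  assumes "ends G e = {u, v}"
  obtains t where "t \<in> {u, v}" "\<And>w. merge_ends G e w = (if w \<in> {u, v} then t else w)"
proof
  show "(SOME t. t \<in> ends G e) \<in> {u, v}" using assms by (metis insertI1 someI)
  show "merge_ends G e w = (if w \<in> {u, v} then SOME t. t \<in> ends G e else w)" for w
    by (simp add: merge_ends_def assms)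
qed

lemma contract_simps:
  assumes "\<not> graph_loop G e"
  shows "verts (contract G e) = merge_ends G e ` verts G" "edges (contract G e) = edges G - {e}"
    "ends (contract G e) d = merge_ends G e ` ends G d" "sign (contract G e) = sign G"
  using assms by (simp_all add: contract_def)

lemma signed_graph_contract:
  assumes G: "signed_graph G" and e: "e \<in> edges G" "\<not> graph_loop G e"
  shows "signed_graph (contract G e)"
proof -
  have "card (merge_ends G e ` ends G d) \<in> {1, 2}" if d: "d \<in> edges G" for d
  proof -
    obtain a b where "ends G d = {a, b}" using ends_cases[OF G d] by metis
    then show ?thesis by (simp add: card_insert_if)
  qed
  then show ?thesis using G e by (auto simp: signed_graph_def contract_simps)
qed

lemma card_verts_contract:
  assumes G: "signed_graph G" and e: "e \<in> edges G" "\<not> graph_loop G e"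
  shows "card (verts G) = Suc (card (verts (contract G e)))"
proof -
  obtain u v where uv: "ends G e = {u, v}" "u \<in> verts G" "v \<in> verts G" "u \<noteq> v"
    using ends_cases[OF G e(1)] e by metis
  obtain t where t: "t \<in> {u, v}" "\<And>w. merge_ends G e w = (if w \<in> {u, v} then t else w)"
    using merge_ends_simps[OF uv(1)] by metis
  have "merge_ends G e ` verts G = verts G - ({u, v} - {t})" using uv t by (auto simp: image_iff)
  moreover have "card ({u, v} - {t}) = 1" using uv t by auto
  moreover have "card (verts G) = card (verts G - ({u, v} - {t})) + card ({u, v} - {t})"
    using uv signed_graph_finite(1)[OF G]
    by (metis Diff_subset card_Diff_subset card_mono finite.emptyI finite_Diff finite_insert insert_subset
        le_add_diff_inverse2 empty_subsetI subset_trans)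
  ultimately show ?thesis using e by (simp add: contract_simps)
qed

text \<open>A positive edge forces equal values at its two ends, so the solutions of
  \<open>G\<close> are exactly the pullbacks along \<open>merge_ends\<close> of the solutions of the
  contraction.\<close>

lemma k\<^sub>b_contract:
  assumes G: "signed_graph G" and e: "e \<in> edges G" "\<not> graph_loop G e" "sign G e = 1"
  shows "k\<^sub>b (contract G e) = k\<^sub>b G"
proof -
  let ?H = "contract G e" and ?m = "merge_ends G e"
  have H: "signed_graph ?H" by (rule signed_graph_contract[OF G e(1,2)])
  obtain u v where uv: "ends G e = {u, v}" "u \<in> verts G" "v \<in> verts G" "u \<noteq> v"
    using ends_cases[OF G e(1)] e by metis
  obtain t where t: "t \<in> {u, v}" "\<And>w. ?m w = (if w \<in> {u, v} then t else w)"
    using merge_ends_simps[OF uv(1)] by metis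
  have mm: "?m (?m w) = ?m w" for w using t by auto
  have mV: "?m w \<in> verts G" if "w \<in> verts G" for w using uv t that by auto
  have gm: "g (?m w) = g w" if "g \<in> sols G" for g w
  proof -
    have "g u = g v" using that e edge_ok_iff[OF G e(1) uv(1), of g] by (auto simp: sols_def)
    then show ?thesis using t by auto
  qed
  have up: "(\<lambda>w. if w \<in> verts G then f (?m w) else 0) \<in> sols G" if f: "f \<in> sols ?H" for f
  proof -
    have "edge_ok G d (\<lambda>w. if w \<in> verts G then f (?m w) else 0)" if d: "d \<in> edges G" for d
    proof -
      obtain a b where ab: "ends G d = {a, b}" "a \<in> verts G" "b \<in> verts G"
        using ends_cases[OF G d] by metis
      show ?thesis
      proof (cases "d = e")
        case True
        then have "?m a = ?m b" using ab uv t by auto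
        then show ?thesis unfolding edge_ok_iff[OF G d ab(1)] using ab e True by simp
      next
        case False
        then have "edge_ok ?H d f" using f d e by (auto simp: sols_def contract_simps)
        then have "f (?m a) = of_int (sign G d) * f (?m b)"
          using ab e by (auto simp: edge_ok_def contract_simps)
        then show ?thesis unfolding edge_ok_iff[OF G d ab(1)] using ab by simp
      qed
    qed
    then show ?thesis by (auto simp: sols_def)
  qed
  have down: "(\<lambda>w. if w \<in> ?m ` verts G then g w else 0) \<in> sols ?H" if g: "g \<in> sols G" for g
  proof -
    have "edge_ok ?H d (\<lambda>w. if w \<in> ?m ` verts G then g w else 0)" if d: "d \<in> edges ?H" for d
    proof -
      have dG: "d \<in> edges G" using d e by (auto simp: contract_simps)
      obtain a b where ab: "ends G d = {a, b}" "a \<in> verts G" "b \<in> verts G"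
        using ends_cases[OF G dG] by metis
      have "g a = of_int (sign G d) * g b"
        using g dG edge_ok_iff[OF G dG ab(1)] by (auto simp: sols_def)
      moreover have "ends ?H d = {?m a, ?m b}" using e ab by (simp add: contract_simps)
      ultimately show ?thesis
        using edge_ok_iff[OF H d] ab e gm[OF g] by (simp add: contract_simps)
    qed
    then show ?thesis using e by (auto simp: sols_def contract_simps)
  qed
  have "bij_betw (\<lambda>f w. if w \<in> verts G then f (?m w) else 0) (sols ?H) (sols G)"
  proof (rule bij_betw_byWitness[where f' = "\<lambda>g w. if w \<in> ?m ` verts G then g w else 0"])
    show "\<forall>f\<in>sols ?H. (\<lambda>w. if w \<in> ?m ` verts G then if w \<in> verts G then f (?m w) else 0 else 0) = f"
      using mm mV e by (auto simp: fun_eq_iff sols_def contract_simps)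
    show "\<forall>g\<in>sols G. (\<lambda>w. if w \<in> verts G then if ?m w \<in> ?m ` verts G then g (?m w) else 0 else 0) = g"
      using gm by (auto simp: fun_eq_iff sols_def)
  qed (use up down in auto)
  then show ?thesis by (rule k\<^sub>b_eqI[OF H G])
qed

lemma spanning_contract:
  assumes "\<not> graph_loop G e" "e \<notin> A"
  shows "spanning (contract G e) A = contract (spanning G (insert e A)) e"
  using assms by (simp add: contract_def spanning_def graph_loop_def merge_ends_def fun_eq_iff)

text \<open>Contraction keeps the number of balanced components and loses one vertex; the lost
  vertex is the summand 1.\<close>

lemma r\<^sub>F_contract:
  assumes G: "signed_graph G" and e: "e \<in> edges G" "\<not> graph_loop G e" "sign G e = 1"
    and A: "A \<subseteq> edges G - {e}"
  shows "r\<^sub>F G (insert e A) = r\<^sub>F (contract G e) A + 1"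
proof -
  have "signed_graph (spanning G (insert e A))"
    by (rule signed_graph_spanning[OF G]) (use e A in auto)
  then have "k\<^sub>b (contract (spanning G (insert e A)) e) = k\<^sub>b (spanning G (insert e A))"
    by (rule k\<^sub>b_contract) (use e in \<open>auto simp: graph_loop_def\<close>)
  moreover have "e \<notin> A" using A by auto
  ultimately show ?thesis using card_verts_contract[OF G e(1,2)] spanning_contract[OF e(2)]
    by (simp add: r\<^sub>F_def)
qed

lemma all_positive_contract: "contract (all_positive G) e = all_positive (contract G e)"
  by (simp add: contract_def all_positive_def delete_def spanning_def graph_loop_def merge_ends_def fun_eq_iff)

lemma r\<^sub>M_contract:
  assumes "signed_graph G" "e \<in> edges G" "\<not> graph_loop G e" "A \<subseteq> edges G - {e}"
  shows "r\<^sub>M G (insert e A) = r\<^sub>M (contract G e) A + 1"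
  using r\<^sub>F_contract[OF signed_graph_all_positive[OF assms(1)], of e A] assms
  by (simp add: r\<^sub>M_all_positive all_positive_contract)

section \<open>Invariance under switching\<close>

lemma switch_simps [simp]:
  "verts (switch v G) = verts G" "edges (switch v G) = edges G" "ends (switch v G) = ends G"
  "graph_loop (switch v G) = graph_loop G" "spanning (switch v G) A = switch v (spanning G A)"
  "all_positive (switch v G) = all_positive G"
  by (simp_all add: switch_def graph_loop_def spanning_def all_positive_def fun_eq_iff)

lemma signed_graph_switch: "signed_graph G \<Longrightarrow> signed_graph (switch v G)"
  by (auto simp: signed_graph_def switch_def)

text \<open>Negating the value at \<open>v\<close> exchanges the two solution sets. At a loop both
  sides of the condition change sign together, in accordance with loops keeping their sign.\<close>

lemma k\<^sub>b_switch:
  assumes G: "signed_graph G"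
  shows "k\<^sub>b (switch v G) = k\<^sub>b G"
proof -
  have ok: "edge_ok (switch v G) e (f(v := - f v)) \<longleftrightarrow> edge_ok G e f" if e: "e \<in> edges G" for e f
  proof -
    obtain a b where ab: "ends G e = {a, b}" "graph_loop G e \<longleftrightarrow> a = b"
      using ends_cases[OF G e] by metis
    have e': "e \<in> edges (switch v G)" "ends (switch v G) e = {a, b}" using e ab by auto
    show ?thesis
      unfolding edge_ok_iff[OF G e ab(1)] edge_ok_iff[OF signed_graph_switch[OF G] e']
      using ab by (auto simp: switch_def)
  qed
  have "bij_betw (\<lambda>f. f(v := - f v)) (sols (switch v G)) (sols G)"
  proof (rule bij_betw_byWitness[where f' = "\<lambda>f. f(v := - f v)"])
    have *: "f(v := - f v, v := - (f(v := - f v)) v) = f" for f :: "_ \<Rightarrow> Enum.finite_3"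
      by (simp add: fun_eq_iff)
    show "(\<lambda>f. f(v := - f v)) ` sols G \<subseteq> sols (switch v G)"
      using ok by (auto simp: sols_def)
    have "f(v := - f v) \<in> sols G" if "f \<in> sols (switch v G)" for f
      using that ok[of _ "f(v := - f v)"] by (auto simp: sols_def)
    then show "(\<lambda>f. f(v := - f v)) ` sols (switch v G) \<subseteq> sols G" by auto
  qed auto
  then show ?thesis by (rule k\<^sub>b_eqI[OF signed_graph_switch[OF G] G])
qed

lemma r\<^sub>F_switch: "signed_graph G \<Longrightarrow> A \<subseteq> edges G \<Longrightarrow> r\<^sub>F (switch v G) A = r\<^sub>F G A"
  by (simp add: r\<^sub>F_def k\<^sub>b_switch signed_graph_spanning)

lemma r\<^sub>M_switch: "r\<^sub>M (switch v G) = r\<^sub>M G"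
  by (simp add: r\<^sub>M_all_positive)

section \<open>Bridges and circuit path edges\<close>

lemma delete_simps [simp]:
  "verts (delete G e) = verts G" "edges (delete G e) = edges G - {e}"
  "ends (delete G e) = ends G" "sign (delete G e) = sign G"
  by (simp_all add: delete_def)

lemma signed_graph_delete: "signed_graph G \<Longrightarrow> signed_graph (delete G e)"
  by (simp add: delete_def signed_graph_spanning)

lemma edge_ok_delete [simp]: "edge_ok (delete G e) = edge_ok G"
  by (simp add: delete_def)

lemma r\<^sub>F_delete [simp]: "r\<^sub>F (delete G e) A = r\<^sub>F G A"
  by (simp add: r\<^sub>F_def delete_def)

lemma r\<^sub>M_delete [simp]: "r\<^sub>M (delete G e) A = r\<^sub>M G A"
  by (simp add: r\<^sub>M_def delete_def)

lemma r\<^sub>F_edge: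
  assumes "signed_graph G" "e \<in> edges G"
  shows "r\<^sub>F G (edges G) = r\<^sub>F G (edges G - {e}) + (if \<forall>f\<in>sols (delete G e). edge_ok G e f then 0 else 1)"
  using r\<^sub>F_insert[OF assms(1) _ assms(2), of "edges G - {e}"] assms(2)
  by (simp add: insert_absorb delete_def)

lemma bridge_iff_rank:
  assumes G: "signed_graph G" and e: "e \<in> edges G" "\<not> graph_loop G e"
  shows "bridge G e \<longleftrightarrow> r\<^sub>M G (edges G) = r\<^sub>M G (edges G - {e}) + 1"
  using r\<^sub>M_insert_cases[OF G _ e(1), of "edges G - {e}"] e
  by (auto simp: bridge_def r\<^sub>M_def delete_def insert_absorb)

text \<open>If the ends were still connected, every solution of the all-positive graph without
  \<open>e\<close> would agree at them. The condition of \<open>e\<close> would then be implied and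
  \<open>r\<^sub>M\<close> would not drop.\<close>

lemma bridge_separates:
  assumes G: "signed_graph G" and e: "bridge G e" "ends G e = {u, v}"
  shows "(u, v) \<notin> (adj (delete G e))\<^sup>*"
proof
  let ?P = "all_positive G"
  assume "(u, v) \<in> (adj (delete G e))\<^sup>*"
  then have uv: "(u, v) \<in> (adj (delete ?P e))\<^sup>*" by (simp add: adj_def)
  have eG: "e \<in> edges G" "\<not> graph_loop G e" using e by (auto simp: bridge_def)
  have P: "signed_graph ?P" "e \<in> edges ?P" "ends ?P e = {u, v}"
    using signed_graph_all_positive[OF G] eG e by auto
  obtain vs es where w: "walk (delete ?P e) vs es" "vs ! 0 = u" "vs ! length es = v"
    using rtrancl_walk[OF uv] by blast
  have "edge_ok ?P e f" if f: "f \<in> sols (delete ?P e)" for f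
  proof -
    have "prod_list (map (sign (delete ?P e)) es) = 1" by (induction es) (auto simp del: all_positive_simps(7))
    then have "f u = f v"
      using walk_sols[OF signed_graph_delete[OF P(1)] f w(1), of "length es"] w by simp
    then show ?thesis unfolding edge_ok_iff[OF P] by simp
  qed
  then have "r\<^sub>M G (edges G) = r\<^sub>M G (edges G - {e})"
    using r\<^sub>F_edge[OF P(1,2)] by (simp add: r\<^sub>M_all_positive)
  then show False using bridge_iff_rank[OF G eG] e by simp
qed

lemma walk_delete: "walk G vs es \<Longrightarrow> e \<notin> set es \<Longrightarrow> walk (delete G e) vs es"
  by (auto simp: walk_def)

lemma cycle_delete: "cycle (delete G e) vs es \<longleftrightarrow> cycle G vs es \<and> e \<notin> set es"
  by (auto simp: cycle_def)

lemma balanced_cycle_delete: "balanced_cycle (delete G e) es \<longleftrightarrow> balanced_cycle G es"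
  by (simp add: balanced_cycle_def)

text \<open>A solution without \<open>e\<close> vanishes on both unbalanced cycles, and the two
  remaining pieces of the path carry this zero to the two ends of \<open>e\<close>. The condition of
  \<open>e\<close> thus holds automatically.\<close>

lemma circuit_path_edge_rank:
  assumes G: "signed_graph G" and e: "e \<in> edges G" "\<not> graph_loop G e"
    and c: "circuit_path_edge G e"
  shows "r\<^sub>F G (edges G) = r\<^sub>F G (edges G - {e})"
proof -
  obtain vs es vs' es' ps fs where h: "cycle G vs es" "\<not> balanced_cycle G es"
    "cycle G vs' es'" "\<not> balanced_cycle G es'"
    and p: "path G ps fs" "set ps \<inter> set vs = {hd ps}" "set ps \<inter> set vs' = {last ps}" "e \<in> set fs"
    using c by (auto simp: circuit_path_edge_def unbalanced_loose_handcuff_def)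
  let ?D = "delete G e"
  have D: "signed_graph ?D" by (rule signed_graph_delete[OF G])
  have l: "length ps = Suc (length fs)" "distinct ps" using p by (auto simp: path_def)
  have w: "walk G ps fs" using p by (auto simp: path_def walk_def)
  obtain i where i: "i < length fs" "fs ! i = e" using p(4) by (auto simp: in_set_conv_nth)
  have ends: "ends G e = {ps ! i, ps ! Suc i}" using w i by (auto simp: walk_def)
  have in_ps: "ps ! i \<in> set ps" "ps ! Suc i \<in> set ps" "ps ! i \<noteq> ps ! Suc i"
    using i l by (auto simp: nth_eq_iff_index_eq)
  \<comment> \<open>Both ends of \<open>e\<close> lie on the path, which meets either cycle in a
    single vertex; so both cycles survive the deletion.\<close>
  have notin: "e \<notin> set ds" if "cycle G cs ds" "set ps \<inter> set cs = {t}" for cs ds t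
  proof
    assume "e \<in> set ds"
    then obtain j where j: "j < length ds" "ds ! j = e" by (auto simp: in_set_conv_nth)
    then have "ends G e = {cs ! j, cs ! ((j + 1) mod length ds)}" "length cs = length ds"
      using that by (auto simp: cycle_def)
    moreover have "(j + 1) mod length ds < length ds" using j by (intro mod_less_divisor) auto
    ultimately have "ends G e \<subseteq> set cs" using j by auto
    then have "{ps ! i, ps ! Suc i} \<subseteq> {t}" using ends that in_ps by blast
    then show False using in_ps by auto
  qed
  \<comment> \<open>As the vertices of the path are distinct, \<open>e\<close> occurs on it only
    once, so the pieces before and after it avoid \<open>e\<close>.\<close>
  have uniq: "fs ! j \<noteq> e" if j: "j < length fs" "j \<noteq> i" for j
  proof
    assume "fs ! j = e"
    then have "{ps ! i, ps ! Suc i} = {ps ! j, ps ! Suc j}" using ends w j by (auto simp: walk_def)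
    then show False using i j l by (auto simp: doubleton_eq_iff nth_eq_iff_index_eq)
  qed
  have w1: "walk ?D (take (Suc i) ps) (take i fs)"
    by (rule walk_delete) (use walk_sub[OF w, of 0 i] i uniq in \<open>auto simp: in_set_conv_nth\<close>)
  have w2: "walk ?D (drop (Suc i) ps) (drop (Suc i) fs)"
    by (rule walk_delete) (use walk_sub[OF w, of "Suc i" "length fs"] i uniq l in
        \<open>auto simp: in_set_conv_nth Suc_diff_Suc\<close>)
  have a1: "(ps ! 0, ps ! i) \<in> (adj ?D)\<^sup>*"
    using walk_in_adj[OF w1, of 0 i] i by (simp add: min_def)
  have a2: "(ps ! Suc i, ps ! length fs) \<in> (adj ?D)\<^sup>*"
  proof -
    have "Suc i + (length fs - Suc i) = length fs" using i by simp
    then show ?thesis using walk_in_adj[OF w2, of 0 "length fs - Suc i"] l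
      by (simp del: add_Suc)
  qed
  have "ps \<noteq> []" using l by auto
  then have hl: "hd ps = ps ! 0" "last ps = ps ! length fs"
    using l by (auto simp: hd_conv_nth last_conv_nth)
  have "edge_ok G e f" if f: "f \<in> sols ?D" for f
  proof -
    have "f (ps ! 0) = 0"
      using sols_vanish_on_negative_cycle[OF D f, of vs es "ps ! 0"] h notin[OF h(1) p(2)] p(2) hl
      by (auto simp: cycle_delete balanced_cycle_delete)
    then have 1: "f (ps ! i) = 0" using sols_vanish_adj[OF D f a1] by simp
    have "f (ps ! length fs) = 0"
      using sols_vanish_on_negative_cycle[OF D f, of vs' es' "ps ! length fs"] h notin[OF h(3) p(3)] p(3) hl
      by (auto simp: cycle_delete balanced_cycle_delete)
    then have "f (ps ! Suc i) = 0" using sols_vanish_adj[OF D f] a2 adj_sym[of ?D] by (metis symD)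
    with 1 show ?thesis unfolding edge_ok_iff[OF G e(1) ends] by simp
  qed
  then show ?thesis using r\<^sub>F_edge[OF G e(1)] by simp
qed

text \<open>An unchanged rank means that the condition of \<open>e\<close> is implied by the others,
  which forces all solutions to vanish on both sides of the bridge. Each side then contains an
  unbalanced cycle, and a shortest walk from one cycle to the other is the path of a
  handcuff.\<close>

lemma bridge_rank_circuit_path_edge:
  assumes G: "signed_graph G" and e: "bridge G e"
    and r: "r\<^sub>F G (edges G) = r\<^sub>F G (edges G - {e})"
  shows "circuit_path_edge G e"
proof -
  let ?D = "delete G e"
  have D: "signed_graph ?D" by (rule signed_graph_delete[OF G])
  have eG: "e \<in> edges G" using e by (simp add: bridge_def)
  obtain u v where uv: "ends G e = {u, v}" "u \<in> verts G" "v \<in> verts G" using ends_cases[OF G eG] by metis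
  have sep: "(u, v) \<notin> (adj ?D)\<^sup>*" by (rule bridge_separates[OF G e uv(1)])
  have ok: "edge_ok G e f" if "f \<in> sols ?D" for f
    using r\<^sub>F_edge[OF G eG] r that by (auto split: if_splits)
  have zero: "f u = 0 \<and> f v = 0" if f: "f \<in> sols ?D" for f
  proof -
    \<comment> \<open>Cutting a solution down to the side of \<open>u\<close> gives another
      solution, as no edge other than \<open>e\<close> leaves that side. It is 0 at
      \<open>v\<close>, so the implied condition of \<open>e\<close> makes it 0 at
      \<open>u\<close>.\<close>
    define g where "g w = (if (u, w) \<in> (adj ?D)\<^sup>* then f w else 0)" for w
    have "edge_ok ?D d g" if d: "d \<in> edges ?D" for d
    proof -
      obtain a b where ab: "ends ?D d = {a, b}" using ends_cases[OF D d] by metis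
      have "(a, b) \<in> (adj ?D)\<^sup>*" "(b, a) \<in> (adj ?D)\<^sup>*"
        using edge_ends_adj[OF d] ab insert_commute by metis+
      then have "(u, a) \<in> (adj ?D)\<^sup>* \<longleftrightarrow> (u, b) \<in> (adj ?D)\<^sup>*" by (meson rtrancl_trans)
      moreover have "edge_ok ?D d f" using f d unfolding sols_def by blast
      ultimately show ?thesis unfolding edge_ok_iff[OF D d ab] by (auto simp: g_def)
    qed
    then have "g \<in> sols ?D" using f by (auto simp: sols_def g_def)
    then have "g u = of_int (sign G e) * g v" using ok edge_ok_iff[OF G eG uv(1)] by blast
    then have "f u = 0" using sep by (simp add: g_def)
    moreover have "f u = of_int (sign G e) * f v" using ok[OF f] edge_ok_iff[OF G eG uv(1)] by blast
    ultimately show ?thesis using sign_cases[OF G eG] by auto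
  qed
  have cyc: "\<exists>cs ds. cycle ?D cs ds \<and> \<not> balanced_cycle ?D ds \<and> set cs \<subseteq> (adj ?D)\<^sup>* `` {t}"
    if t: "t = u \<or> t = v" for t
  proof -
    have C: "(adj ?D)\<^sup>* `` {t} \<in> components ?D" using t uv by (auto simp: components_alt)
    have "\<not> balanced_component ?D ((adj ?D)\<^sup>* `` {t})"
      using balanced_component_nonvanishing[OF D C, of t] t zero by auto
    then show ?thesis by (auto simp: balanced_component_def)
  qed
  obtain cs ds where c: "cycle ?D cs ds" "\<not> balanced_cycle ?D ds" "set cs \<subseteq> (adj ?D)\<^sup>* `` {u}"
    using cyc[of u] by blast
  obtain cs' ds' where c': "cycle ?D cs' ds'" "\<not> balanced_cycle ?D ds'" "set cs' \<subseteq> (adj ?D)\<^sup>* `` {v}"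
    using cyc[of v] by blast
  have far: "(a, b) \<notin> (adj ?D)\<^sup>*" if "a \<in> set cs" "b \<in> set cs'" for a b
  proof
    assume "(a, b) \<in> (adj ?D)\<^sup>*"
    moreover have "(u, a) \<in> (adj ?D)\<^sup>*" "(b, v) \<in> (adj ?D)\<^sup>*"
      using that c(3) c'(3) adj_sym[of ?D] by (auto dest: symD)
    ultimately show False using sep by (meson rtrancl_trans)
  qed
  have mono: "(adj ?D)\<^sup>* \<subseteq> (adj G)\<^sup>*" by (rule rtrancl_mono) (auto simp: adj_def)
  \<comment> \<open>Minimality of the length supplies everything a handcuff requires of its path:
    distinct vertices, and no contact with the cycles except at its two ends.\<close>
  define P where "P n \<longleftrightarrow> (\<exists>ps fs. walk G ps fs \<and> length fs = n \<and> ps ! 0 \<in> set cs \<and> ps ! n \<in> set cs')" for n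
  have "\<exists>n. P n"
  proof -
    have cs0: "cs ! 0 \<in> set cs" "cs' ! 0 \<in> set cs'" using c c' by (auto simp: cycle_def)
    then have "(cs ! 0, u) \<in> (adj G)\<^sup>*" "(v, cs' ! 0) \<in> (adj G)\<^sup>*"
      using c(3) c'(3) mono adj_sym[of G] by (auto dest: symD)
    then have "(cs ! 0, cs' ! 0) \<in> (adj G)\<^sup>*"
      using edge_ends_adj[OF eG uv(1)] by (meson rtrancl_trans)
    then show ?thesis using rtrancl_walk[of "cs ! 0" "cs' ! 0" G] cs0 unfolding P_def by metis
  qed
  then obtain n where n: "P n" and least: "\<And>m. m < n \<Longrightarrow> \<not> P m" by (metis exists_least_iff)
  obtain ps fs where w: "walk G ps fs" "length fs = n" "ps ! 0 \<in> set cs" "ps ! n \<in> set cs'"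
    using n by (auto simp: P_def)
  have l: "length ps = Suc n" using w by (simp add: walk_def)
  have dist: "ps ! i \<noteq> ps ! j" if ij: "i < j" "j \<le> n" for i j
  proof
    assume eq: "ps ! i = ps ! j"
    let ?ps = "take (Suc i) ps @ drop (Suc j) ps" and ?fs = "take i fs @ drop j fs"
    have "walk G ?ps ?fs" using walk_cut[OF w(1), of i j] ij w(2) eq by simp
    moreover have "length ?fs = n - (j - i)" using ij w(2) by simp
    moreover have "?ps ! 0 = ps ! 0" using l by (simp add: nth_append)
    moreover have "?ps ! (n - (j - i)) = ps ! n"
    proof (cases "j = n")
      case True then show ?thesis using ij l eq by (simp add: nth_append)
    next
      case False
      then have "Suc j + (n - (j - i) - Suc i) = n" "\<not> n - (j - i) < Suc i" using ij by auto
      then show ?thesis using ij l by (simp add: nth_append)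
    qed
    ultimately have "P (n - (j - i))" using w unfolding P_def by metis
    then show False using least ij by force
  qed
  have first: "i = 0" if i: "i \<le> n" "ps ! i \<in> set cs" for i
  proof (rule ccontr)
    assume "i \<noteq> 0"
    have "walk G (drop i ps) (drop i fs)"
      using walk_sub[OF w(1), of i n] i w(2) l by (simp add: Suc_diff_le)
    then have "P (n - i)" unfolding P_def using i w l by (intro exI[of _ "drop i ps"] exI[of _ "drop i fs"]) auto
    then show False using least[of "n - i"] i \<open>i \<noteq> 0\<close> by simp
  qed
  have final: "i = n" if i: "i \<le> n" "ps ! i \<in> set cs'" for i
  proof (rule ccontr)
    assume "i \<noteq> n"
    have "walk G (take (Suc i) ps) (take i fs)"
      using walk_sub[OF w(1), of 0 i] i w(2) by simp
    then have "P i" unfolding P_def using i w l by (intro exI[of _ "take (Suc i) ps"] exI[of _ "take i fs"]) auto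
    then show False using least[of i] i \<open>i \<noteq> n\<close> by simp
  qed
  \<comment> \<open>A walk avoiding \<open>e\<close> cannot pass from the side of \<open>u\<close>
    to the side of \<open>v\<close>.\<close>
  have "e \<in> set fs"
  proof (rule ccontr)
    assume "e \<notin> set fs"
    then have "walk ?D ps fs" using walk_delete[OF w(1)] by simp
    then have "(ps ! 0, ps ! n) \<in> (adj ?D)\<^sup>*" using walk_in_adj[of ?D ps fs 0 n] w by simp
    then show False using far w by blast
  qed
  moreover have "path G ps fs"
  proof -
    have "distinct ps" unfolding distinct_conv_nth using dist l by (metis less_Suc_eq_le linorder_neqE_nat)
    moreover have "set ps \<subseteq> verts G"
    proof
      fix t assume "t \<in> set ps"
      then obtain i where i: "i \<le> n" "t = ps ! i" using l by (auto simp: in_set_conv_nth less_Suc_eq_le)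
      have "(ps ! 0, t) \<in> (adj G)\<^sup>*" using walk_in_adj[OF w(1), of 0 i] i w by simp
      moreover have "ps ! 0 \<in> verts G" using w c by (auto simp: cycle_def)
      ultimately show "t \<in> verts G" using adj_verts[OF G] by blast
    qed
    ultimately show ?thesis using w by (auto simp: path_def walk_def)
  qed
  moreover have "set ps \<inter> set cs = {hd ps}"
  proof -
    have "ps \<noteq> []" using l by auto
    then have h: "hd ps = ps ! 0" "ps ! 0 \<in> set ps" using l by (auto simp: hd_conv_nth)
    have "t = ps ! 0" if t: "t \<in> set ps" "t \<in> set cs" for t
    proof -
      obtain i where "i \<le> n" "t = ps ! i" using t(1) l by (auto simp: in_set_conv_nth less_Suc_eq_le)
      then show ?thesis using first[of i] t(2) by simp
    qed
    then show ?thesis unfolding h(1) using h(2) w(3) by blast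
  qed
  moreover have "set ps \<inter> set cs' = {last ps}"
  proof -
    have "ps \<noteq> []" using l by auto
    then have h: "last ps = ps ! n" "ps ! n \<in> set ps" using l by (auto simp: last_conv_nth)
    have "t = ps ! n" if t: "t \<in> set ps" "t \<in> set cs'" for t
    proof -
      obtain i where "i \<le> n" "t = ps ! i" using t(1) l by (auto simp: in_set_conv_nth less_Suc_eq_le)
      then show ?thesis using final[of i] t(2) by simp
    qed
    then show ?thesis unfolding h(1) using h(2) w(4) by blast
  qed
  moreover have "set cs \<inter> set cs' = {}" using far by blast
  ultimately have "unbalanced_loose_handcuff G cs ds cs' ds' ps fs \<and> e \<in> set fs"
    using c c' by (auto simp: unbalanced_loose_handcuff_def cycle_delete balanced_cycle_delete)
  then show ?thesis unfolding circuit_path_edge_def by blast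
qed

section \<open>The subset expansion under deletion and contraction\<close>

lemma sum_Pow_insert:
  assumes "finite E" "e \<notin> E"
  shows "(\<Sum>A\<in>Pow (insert e E). F A) = (\<Sum>A\<in>Pow E. F A) + (\<Sum>A\<in>Pow E. F (insert e A) :: 'k::comm_monoid_add)"
proof -
  have "(\<Sum>A\<in>insert e ` Pow E. F A) = (\<Sum>A\<in>Pow E. F (insert e A))"
    using assms by (subst sum.reindex) (auto simp: inj_on_def)
  moreover have "(\<Sum>A\<in>Pow (insert e E). F A) = (\<Sum>A\<in>Pow E. F A) + (\<Sum>A\<in>insert e ` Pow E. F A)"
    unfolding Pow_insert using assms by (intro sum.union_disjoint) auto
  ultimately show ?thesis by simp
qed

text \<open>Nonnegativity of the exponent takes the place of \<open>c \<noteq> 0\<close>; with c = 0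
  and n = -1 the equation fails.\<close>

lemma power_int_Suc: "0 \<le> n \<Longrightarrow> c powi (n + 1) = c * c powi n" for c :: "'k::field"
  by (subst power_int_add_1) auto

context
  fixes \<alpha> \<beta> \<gamma> x y z :: "'k::field"
begin

text \<open>With the six exponents as separate arguments, comparing terms of \<open>G\<close>, its
  deletion and its contraction becomes linear integer arithmetic.\<close>

definition monomial :: "int \<Rightarrow> int \<Rightarrow> int \<Rightarrow> int \<Rightarrow> int \<Rightarrow> int \<Rightarrow> 'k" where
  "monomial a b c d e f = \<alpha> powi a * \<beta> powi b * \<gamma> powi c * (x - \<alpha>) powi d * (y - \<beta>) powi e * (z - \<gamma>) powi f"

definition subset_term :: "('v, 'e) sgraph \<Rightarrow> 'e set \<Rightarrow> 'k" where
  "subset_term G A = monomial (r\<^sub>M G A) (int (card (edges G)) - int (card A) + r\<^sub>F G A - r\<^sub>F G (edges G))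
     (r\<^sub>F G (edges G) - r\<^sub>F G A - (r\<^sub>M G (edges G) - r\<^sub>M G A)) (r\<^sub>M G (edges G) - r\<^sub>M G A)
     (int (card A) - r\<^sub>F G A) (r\<^sub>F G A - r\<^sub>M G A)"

definition subset_sum :: "('v, 'e) sgraph \<Rightarrow> 'k" where
  "subset_sum G = (\<Sum>A\<in>Pow (edges G). subset_term G A)"

text \<open>The exponent of \<gamma> is absent: it equals the number of unbalanced components of
  \<open>G\<close> minus that of the subgraph, and is negative when edges outside \<open>A\<close>
  join unbalanced components.\<close>

lemma subset_exponents_nonneg:
  assumes "signed_graph G" "A \<subseteq> edges G"
  shows "0 \<le> r\<^sub>M G A" "0 \<le> int (card (edges G)) - int (card A) + r\<^sub>F G A - r\<^sub>F G (edges G)"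
    "0 \<le> r\<^sub>M G (edges G) - r\<^sub>M G A" "0 \<le> int (card A) - r\<^sub>F G A" "0 \<le> r\<^sub>F G A - r\<^sub>M G A"
  using r\<^sub>M_bounds[OF assms(1), of "{}" A] r\<^sub>M_bounds[OF assms(1), of A "edges G"]
    r\<^sub>F_bounds[OF assms(1), of "{}" A] r\<^sub>F_bounds[OF assms(1), of A "edges G"]
    r\<^sub>M_le_r\<^sub>F[OF assms] r\<^sub>M_empty[OF assms(1)] r\<^sub>F_empty[OF assms(1)] assms(2)
  by auto

lemma subset_sum_split:
  assumes "signed_graph G" "e \<in> edges G"
  shows "subset_sum G = (\<Sum>A\<in>Pow (edges G - {e}). subset_term G (insert e A)) +
    (\<Sum>A\<in>Pow (edges G - {e}). subset_term G A)"
  using sum_Pow_insert[of "edges G - {e}" e "subset_term G"] assms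
  by (simp add: subset_sum_def signed_graph_finite insert_absorb add.commute)

lemma card_edges_delete: "signed_graph G \<Longrightarrow> e \<in> edges G \<Longrightarrow> card (edges G) = card (edges G - {e}) + 1"
  by (metis Suc_eq_plus1 card_Suc_Diff1 signed_graph_finite(2))

lemma card_insert_edge: 
  "signed_graph G \<Longrightarrow> A \<subseteq> edges G - {e} \<Longrightarrow> card (insert e A) = card A + 1"
  by (metis Diff_insert_absorb Suc_eq_plus1 card_insert_disjoint finite_Diff finite_subset
      insertI1 signed_graph_finite(2) subset_Diff_insert)

text \<open>All four ranks and both cardinalities decrease by one, so every exponent stays the same
  except that of \<alpha>.\<close>

lemma subset_term_contract:
  assumes G: "signed_graph G" and e: "e \<in> edges G" "\<not> graph_loop G e" "sign G e = 1"
    and A: "A \<subseteq> edges G - {e}"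
  shows "subset_term G (insert e A) = \<alpha> * subset_term (contract G e) A"
proof -
  let ?H = "contract G e"
  have E: "insert e (edges G - {e}) = edges G" using e by auto
  have H: "signed_graph ?H" "A \<subseteq> edges ?H" "edges ?H = edges G - {e}"
    using signed_graph_contract[OF G e(1,2)] A e by (auto simp: contract_simps)
  have r: "r\<^sub>M G (insert e A) = r\<^sub>M ?H A + 1" "r\<^sub>F G (insert e A) = r\<^sub>F ?H A + 1"
    "r\<^sub>M G (edges G) = r\<^sub>M ?H (edges ?H) + 1" "r\<^sub>F G (edges G) = r\<^sub>F ?H (edges ?H) + 1"
    using r\<^sub>M_contract[OF G e(1,2) A] r\<^sub>F_contract[OF G e A]
      r\<^sub>M_contract[OF G e(1,2) order_refl] r\<^sub>F_contract[OF G e order_refl] H(3) E by simp_all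
  have "subset_term G (insert e A) = monomial (r\<^sub>M ?H A + 1)
      (int (card (edges ?H)) - int (card A) + r\<^sub>F ?H A - r\<^sub>F ?H (edges ?H))
     (r\<^sub>F ?H (edges ?H) - r\<^sub>F ?H A - (r\<^sub>M ?H (edges ?H) - r\<^sub>M ?H A)) (r\<^sub>M ?H (edges ?H) - r\<^sub>M ?H A)
     (int (card A) - r\<^sub>F ?H A) (r\<^sub>F ?H A - r\<^sub>M ?H A)"
    unfolding subset_term_def r card_edges_delete[OF G e(1)] card_insert_edge[OF G A] H(3)
    by (simp add: algebra_simps)
  also have "\<dots> = \<alpha> * subset_term ?H A"
    unfolding subset_term_def monomial_def using power_int_Suc[OF subset_exponents_nonneg(1)[OF H(1,2)], of \<alpha>]
    by (simp add: mult.assoc)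
  finally show ?thesis .
qed

lemma sum_contract:
  assumes G: "signed_graph G" and e: "e \<in> edges G" "\<not> graph_loop G e" "sign G e = 1"
  shows "(\<Sum>A\<in>Pow (edges G - {e}). subset_term G (insert e A)) = \<alpha> * subset_sum (contract G e)"
  unfolding subset_sum_def contract_simps(2)[OF e(2)] sum_distrib_left
  by (rule sum.cong) (use subset_term_contract[OF G e] in auto)

lemma subset_term_delete:
  assumes G: "signed_graph G" and e: "e \<in> edges G" and A: "A \<subseteq> edges G - {e}"
    and rM: "r\<^sub>M G (edges G) = r\<^sub>M G (edges G - {e}) + i" and rF: "r\<^sub>F G (edges G) = r\<^sub>F G (edges G - {e}) + j"
  shows "subset_term G A = monomial (r\<^sub>M G A)
     (int (card (edges G - {e})) - int (card A) + r\<^sub>F G A - r\<^sub>F G (edges G - {e}) + (1 - j))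
     (r\<^sub>F G (edges G - {e}) - r\<^sub>F G A - (r\<^sub>M G (edges G - {e}) - r\<^sub>M G A) + (j - i))
     (r\<^sub>M G (edges G - {e}) - r\<^sub>M G A + i)
     (int (card A) - r\<^sub>F G A) (r\<^sub>F G A - r\<^sub>M G A)"
  unfolding subset_term_def rM rF card_edges_delete[OF G e] by (simp add: algebra_simps)

lemma subset_term_deleted:
  "subset_term (delete G e) A = monomial (r\<^sub>M G A)
     (int (card (edges G - {e})) - int (card A) + r\<^sub>F G A - r\<^sub>F G (edges G - {e}))
     (r\<^sub>F G (edges G - {e}) - r\<^sub>F G A - (r\<^sub>M G (edges G - {e}) - r\<^sub>M G A))
     (r\<^sub>M G (edges G - {e}) - r\<^sub>M G A)
     (int (card A) - r\<^sub>F G A) (r\<^sub>F G A - r\<^sub>M G A)"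
  by (simp add: subset_term_def)

lemma sum_delete:
  assumes "\<And>A. A \<subseteq> edges G - {e} \<Longrightarrow> subset_term G A = c * subset_term (delete G e) A"
  shows "(\<Sum>A\<in>Pow (edges G - {e}). subset_term G A) = c * subset_sum (delete G e)"
  unfolding subset_sum_def delete_simps sum_distrib_left
  by (rule sum.cong) (use assms in auto)

text \<open>Here i and j are the drops of \<open>r\<^sub>M\<close> and \<open>r\<^sub>F\<close> when
  \<open>e\<close> is deleted. The factors for (0,0), (0,1), (1,0), (1,1) are \<beta>, \<gamma>,
  \<beta>(x - \<alpha>)/\<gamma> and x - \<alpha>: the first three are the deletion coefficients of
  the recurrences, and the last leads to the coefficient x.\<close>

lemma subset_term_delete_cases:
  assumes G: "signed_graph G" and e: "e \<in> edges G" and A: "A \<subseteq> edges G - {e}" and \<gamma>: "\<gamma> \<noteq> 0"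
    and ij: "i = 0 \<or> i = 1" "j = 0 \<or> j = 1"
    and rM: "r\<^sub>M G (edges G) = r\<^sub>M G (edges G - {e}) + i" and rF: "r\<^sub>F G (edges G) = r\<^sub>F G (edges G - {e}) + j"
  shows "subset_term G A =
    (if j = 0 then \<beta> else 1) * \<gamma> powi (j - i) * (if i = 1 then x - \<alpha> else 1) * subset_term (delete G e) A"
proof -
  have A': "A \<subseteq> edges (delete G e)" using A by simp
  note nn = subset_exponents_nonneg[OF signed_graph_delete[OF G] A', simplified]
  let ?b = "int (card (edges G - {e})) - int (card A) + r\<^sub>F G A - r\<^sub>F G (edges G - {e})"
  let ?d = "r\<^sub>M G (edges G - {e}) - r\<^sub>M G A"
  let ?c = "r\<^sub>F G (edges G - {e}) - r\<^sub>F G A - (r\<^sub>M G (edges G - {e}) - r\<^sub>M G A)"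
  have 1: "\<beta> powi (?b + (1 - j)) = (if j = 0 then \<beta> else 1) * \<beta> powi ?b"
    using ij(2) power_int_Suc[of ?b \<beta>] nn(2) by (elim disjE) simp_all
  have 2: "(x - \<alpha>) powi (?d + i) = (if i = 1 then x - \<alpha> else 1) * (x - \<alpha>) powi ?d"
    using ij(1) power_int_Suc[of ?d "x - \<alpha>"] nn(3) by (elim disjE) simp_all
  have 3: "\<gamma> powi (?c + (j - i)) = \<gamma> powi (j - i) * \<gamma> powi ?c"
    using \<gamma> by (simp add: power_int_add)
  show ?thesis
    unfolding subset_term_delete[OF G e A rM rF] subset_term_deleted monomial_def 1 2 3
    by (simp only: mult_ac)
qed

lemma subset_sum_delete_contract:
  assumes G: "signed_graph G" and e: "e \<in> edges G" "\<not> graph_loop G e" "sign G e = 1" and \<gamma>: "\<gamma> \<noteq> 0"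
    and ij: "i = 0 \<or> i = 1" "j = 0 \<or> j = 1"
    and rM: "r\<^sub>M G (edges G) = r\<^sub>M G (edges G - {e}) + i" and rF: "r\<^sub>F G (edges G) = r\<^sub>F G (edges G - {e}) + j"
  shows "subset_sum G = \<alpha> * subset_sum (contract G e) +
    (if j = 0 then \<beta> else 1) * \<gamma> powi (j - i) * (if i = 1 then x - \<alpha> else 1) * subset_sum (delete G e)"
  unfolding subset_sum_split[OF G e(1)] sum_contract[OF G e]
  by (intro arg_cong[where f = "\<lambda>t. _ + t"] sum_delete subset_term_delete_cases assms)

text \<open>If \<open>e\<close> is a coloop of both matroids, deletion and contraction have the same
  rank functions and hence the same expansion. The two coefficients then add up to \<alpha> + (x -
  \<alpha>) = x.\<close>

lemma subset_sum_bridge: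
  assumes G: "signed_graph G" and e: "e \<in> edges G" "\<not> graph_loop G e" "sign G e = 1" and \<gamma>: "\<gamma> \<noteq> 0"
    and rM: "r\<^sub>M G (edges G) = r\<^sub>M G (edges G - {e}) + 1" and rF: "r\<^sub>F G (edges G) = r\<^sub>F G (edges G - {e}) + 1"
  shows "subset_sum G = x * subset_sum (contract G e)"
proof -
  have E: "insert e (edges G - {e}) = edges G" using e by auto
  have "subset_term (delete G e) A = subset_term (contract G e) A" if A: "A \<subseteq> edges G - {e}" for A
  proof -
    have coloop: "r\<^sub>M G (insert e B) = r\<^sub>M G B + 1" "r\<^sub>F G (insert e B) = r\<^sub>F G B + 1"
      if "B \<subseteq> edges G - {e}" for B
      using r\<^sub>M_insert_mono[OF G that _ e(1)] r\<^sub>F_insert_mono[OF G that _ e(1)] rM rF E by auto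
    have "r\<^sub>M (contract G e) B = r\<^sub>M G B" "r\<^sub>F (contract G e) B = r\<^sub>F G B"
      if "B \<subseteq> edges G - {e}" for B
      using coloop[OF that] r\<^sub>M_contract[OF G e(1,2) that] r\<^sub>F_contract[OF G e that] by auto
    from this[OF A] this[OF order_refl] show ?thesis
      using e by (simp add: subset_term_def contract_simps)
  qed
  then have "subset_sum (delete G e) = subset_sum (contract G e)"
    using e by (auto simp: subset_sum_def contract_simps intro: sum.cong)
  then show ?thesis
    using subset_sum_delete_contract[OF G e \<gamma>, of 1 1] rM rF by (simp add: algebra_simps)
qed

text \<open>Adding \<open>e\<close> to a set leaves both ranks unchanged. Sets without
  \<open>e\<close> contribute the factor \<beta>, those with \<open>e\<close> the factor y -
  \<beta>.\<close>

lemma subset_sum_positive_loop: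
  assumes G: "signed_graph G" and e: "e \<in> edges G" "graph_loop G e" "sign G e = 1" and \<gamma>: "\<gamma> \<noteq> 0"
  shows "subset_sum G = y * subset_sum (delete G e)"
proof -
  have E: "insert e (edges G - {e}) = edges G" using e by auto
  have r: "r\<^sub>M G (insert e A) = r\<^sub>M G A" "r\<^sub>F G (insert e A) = r\<^sub>F G A" if "A \<subseteq> edges G - {e}" for A
    using r\<^sub>M_loop[OF G _ e(1,2), of A] r\<^sub>F_positive_loop[OF G _ e, of A] that by auto
  have rE: "r\<^sub>M G (edges G) = r\<^sub>M G (edges G - {e}) + 0" "r\<^sub>F G (edges G) = r\<^sub>F G (edges G - {e}) + 0"
    using r[OF order_refl] E by auto
  have del: "subset_term G A = \<beta> * subset_term (delete G e) A" if A: "A \<subseteq> edges G - {e}" for A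
    using subset_term_delete_cases[OF G e(1) A \<gamma> _ _ rE] by simp
  have ins: "subset_term G (insert e A) = (y - \<beta>) * subset_term (delete G e) A" if A: "A \<subseteq> edges G - {e}" for A
  proof -
    have A': "A \<subseteq> edges (delete G e)" using A by simp
    have "subset_term G (insert e A) = monomial (r\<^sub>M G A)
     (int (card (edges G - {e})) - int (card A) + r\<^sub>F G A - r\<^sub>F G (edges G - {e}))
     (r\<^sub>F G (edges G - {e}) - r\<^sub>F G A - (r\<^sub>M G (edges G - {e}) - r\<^sub>M G A))
     (r\<^sub>M G (edges G - {e}) - r\<^sub>M G A)
     (int (card A) - r\<^sub>F G A + 1) (r\<^sub>F G A - r\<^sub>M G A)"
      unfolding subset_term_def r[OF A] rE card_edges_delete[OF G e(1)] card_insert_edge[OF G A]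
      by (simp add: algebra_simps)
    also have "\<dots> = (y - \<beta>) * subset_term (delete G e) A"
      unfolding subset_term_deleted monomial_def
      using power_int_Suc[of "int (card A) - r\<^sub>F G A" "y - \<beta>"]
        subset_exponents_nonneg(4)[OF signed_graph_delete[OF G] A'] by simp
    finally show ?thesis .
  qed
  have "(\<Sum>A\<in>Pow (edges G - {e}). subset_term G (insert e A)) = (y - \<beta>) * subset_sum (delete G e)"
    unfolding subset_sum_def delete_simps sum_distrib_left by (rule sum.cong) (use ins in auto)
  moreover have "(\<Sum>A\<in>Pow (edges G - {e}). subset_term G A) = \<beta> * subset_sum (delete G e)"
    by (rule sum_delete[OF del])
  ultimately show ?thesis unfolding subset_sum_split[OF G e(1)] by (simp add: algebra_simps)
qed

lemma subset_sum_switch: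
  assumes "signed_graph G"
  shows "subset_sum (switch v G) = subset_sum G"
  unfolding subset_sum_def using assms
  by (intro sum.cong) (auto simp: subset_term_def r\<^sub>F_switch r\<^sub>M_switch)

end

section \<open>Graphs all of whose edges are negative loops\<close>

definition negative_loop_graph :: "('v, 'e) sgraph \<Rightarrow> bool" where
  "negative_loop_graph G \<longleftrightarrow> signed_graph G \<and> (\<forall>e\<in>edges G. graph_loop G e \<and> sign G e = - 1)"

lemma r\<^sub>M_loops:
  assumes "negative_loop_graph G" "A \<subseteq> edges G"
  shows "r\<^sub>M G A = 0"
proof -
  have G: "signed_graph G" using assms by (simp add: negative_loop_graph_def)
  have "finite A" using assms(2) signed_graph_finite(2)[OF G] finite_subset by metis
  then show ?thesis using assms(2)
    by (induction A) (use assms(1) in \<open>auto simp: r\<^sub>M_empty[OF G] r\<^sub>M_loop[OF G] negative_loop_graph_def\<close>)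
qed

text \<open>A negative loop forces the value 0 at its vertex, so the rank counts the vertices
  carrying a loop of \<open>A\<close>, however many loops each carries.\<close>

lemma r\<^sub>F_negative_loops:
  assumes N: "negative_loop_graph G" and A: "A \<subseteq> edges G"
  shows "r\<^sub>F G A = int (card (\<Union>(ends G ` A)))"
proof -
  have G: "signed_graph G" using N by (simp add: negative_loop_graph_def)
  let ?U = "\<Union>(ends G ` A)"
  have U: "?U \<subseteq> verts G" using G A by (auto simp: signed_graph_def)
  have ok: "edge_ok G e f \<longleftrightarrow> (\<forall>w\<in>ends G e. f w = 0)" if e: "e \<in> A" for e f
  proof -
    have e': "e \<in> edges G" "graph_loop G e" "sign G e = - 1" using e A N by (auto simp: negative_loop_graph_def)
    then obtain w where w: "ends G e = {w, w}" using ends_cases[OF G] by metis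
    show ?thesis unfolding edge_ok_iff[OF G e'(1) w] w using e' by (simp add: finite_3_eq_neg)
  qed
  have "sols (spanning G A) = {f. \<forall>v. v \<notin> verts G - ?U \<longrightarrow> f v = 0}"
    by (auto simp: sols_def ok)
  then have "(3::nat) ^ k\<^sub>b (spanning G A) = 3 ^ card (verts G - ?U)"
    using card_sols[OF signed_graph_spanning[OF G A]]
      card_supported_functions[of "verts G - ?U"] signed_graph_finite(1)[OF G] by simp
  then have "k\<^sub>b (spanning G A) = card (verts G - ?U)" by simp
  moreover have "card (verts G - ?U) = card (verts G) - card ?U" "card ?U \<le> card (verts G)"
    using U signed_graph_finite(1)[OF G] by (auto intro: card_Diff_subset finite_subset card_mono)
  ultimately show ?thesis by (simp add: r\<^sub>F_def)
qed

lemma sum_Pow_binomial: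
  fixes b p :: "'k::comm_ring_1"
  assumes "finite E"
  shows "(\<Sum>A\<in>Pow E. b ^ (card E - card A) * p ^ card A) = (b + p) ^ card E"
proof -
  have "(b + p) ^ card E = (\<Sum>A\<in>Pow E. p ^ card A * b ^ card (E - A))"
    using prod_add[OF assms, of "\<lambda>_. p" "\<lambda>_. b"] by (simp add: add.commute)
  also have "\<dots> = (\<Sum>A\<in>Pow E. b ^ (card E - card A) * p ^ card A)"
    using assms by (intro sum.cong) (auto simp: card_Diff_subset finite_subset)
  finally show ?thesis ..
qed

text \<open>Both sides are the quotient of y^l - b^l by y - b, where l is the size of
  \<open>E\<close>. Induction avoids the division, as y = b is possible: both sides pass from l to l
  + 1 by multiplying with b and adding y^l.\<close>

lemma sum_nonempty_subsets:
  fixes b y :: "'k::comm_ring_1"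
  assumes "finite E"
  shows "(\<Sum>A\<in>Pow E. if A = {} then 0 else b ^ (card E - card A) * (y - b) ^ (card A - 1)) =
    (\<Sum>i<card E. y ^ (card E - 1 - i) * b ^ i)"
  using assms
proof (induction E)
  case (insert e E)
  let ?F = "\<lambda>E A. if A = {} then 0 else b ^ (card E - card A) * (y - b) ^ (card A - 1)"
  have fin: "finite A" "e \<notin> A" "card A \<le> card E" if "A \<in> Pow E" for A
    using that insert finite_subset card_mono by auto
  have "(\<Sum>A\<in>Pow E. ?F (insert e E) A) = b * (\<Sum>A\<in>Pow E. ?F E A)"
    unfolding sum_distrib_left using fin insert by (intro sum.cong) (auto simp: Suc_diff_le)
  moreover have "(\<Sum>A\<in>Pow E. ?F (insert e E) (insert e A)) =
      (\<Sum>A\<in>Pow E. b ^ (card E - card A) * (y - b) ^ card A)"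
    using fin insert by (intro sum.cong) auto
  moreover have "\<dots> = y ^ card E" using sum_Pow_binomial[OF insert(1), of b "y - b"] by simp
  moreover have "b * (\<Sum>i<card E. y ^ (card E - 1 - i) * b ^ i) = (\<Sum>i<card E. y ^ (card E - Suc i) * b ^ Suc i)"
    unfolding sum_distrib_left by (intro sum.cong) (auto simp: algebra_simps)
  ultimately show ?case using insert
    by (simp add: sum_Pow_insert sum.lessThan_Suc_shift del: sum.lessThan_Suc)
qed simp

lemma power_int_add_nonneg: "0 \<le> m \<Longrightarrow> 0 \<le> n \<Longrightarrow> c powi (m + n) = c powi m * c powi n" for c :: "'k::field"
  by (simp add: power_int_def nat_add_distrib power_add)

text \<open>At one vertex \<open>r\<^sub>F\<close> is 0 on the empty set and 1 on all others. The
  empty set yields the summand with \<gamma>, and each nonempty set has the factor z -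
  \<gamma>.\<close>

lemma subset_sum_single_vertex:
  fixes \<alpha> \<beta> \<gamma> x y z :: "'k::field"
  assumes N: "negative_loop_graph G" and v: "verts G = {v}"
  shows "subset_sum \<alpha> \<beta> \<gamma> x y z G = (if edges G = {} then 1 else
    \<beta> ^ (card (edges G) - 1) * \<gamma> + (z - \<gamma>) * (\<Sum>i=0..card (edges G) - 1. y ^ (card (edges G) - 1 - i) * \<beta> ^ i))"
proof -
  have G: "signed_graph G" using N by (simp add: negative_loop_graph_def)
  let ?E = "edges G" let ?l = "card ?E"
  have fE: "finite ?E" using signed_graph_finite(2)[OF G] .
  have rF: "r\<^sub>F G A = (if A = {} then 0 else 1)" if A: "A \<subseteq> ?E" for A
  proof (cases "A = {}")
    case True then show ?thesis using r\<^sub>F_empty[OF G] by simp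
  next
    case False
    have "ends G e = {v}" if "e \<in> A" for e
    proof -
      have "e \<in> ?E" using A that by auto
      then have "ends G e \<subseteq> {v}" "card (ends G e) \<noteq> 0" using G v by (auto simp: signed_graph_def)
      then show ?thesis by (metis card.empty subset_singletonD)
    qed
    then have "\<Union>(ends G ` A) = {v}" using False by auto
    then show ?thesis using r\<^sub>F_negative_loops[OF N A] False by simp
  qed
  have rM: "r\<^sub>M G A = 0" if "A \<subseteq> ?E" for A using r\<^sub>M_loops[OF N that] .
  show ?thesis
  proof (cases "?E = {}")
    case True
    then show ?thesis by (simp add: subset_sum_def subset_term_def monomial_def rF rM)
  next
    case False
    then have l: "?l \<ge> 1" using fE by (simp add: Suc_le_eq card_gt_0_iff)
    let ?F = "\<lambda>A. if A = {} then 0 else \<beta> ^ (?l - card A) * (y - \<beta>) ^ (card A - 1)"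
    have "subset_term \<alpha> \<beta> \<gamma> x y z G A = (if A = {} then \<beta> ^ (?l - 1) * \<gamma> else 0) + (z - \<gamma>) * ?F A"
      if A: "A \<in> Pow ?E" for A
    proof (cases "A = {}")
      case True
      have "int ?l - 1 = int (?l - 1)" using l by simp
      then show ?thesis using True rF[of ?E] rF[of "{}"] rM[of ?E] rM[of "{}"] False
        by (simp add: subset_term_def monomial_def del: of_nat_diff)
    next
      case nonempty: False
      have c: "card A \<le> ?l" "card A \<ge> 1"
        using A fE nonempty by (auto simp: card_mono Suc_le_eq card_gt_0_iff intro: finite_subset)
      then have "int ?l - int (card A) = int (?l - card A)" "int (card A) - 1 = int (card A - 1)" by auto
      then show ?thesis using nonempty rF[of ?E] rF[of A] rM[of ?E] rM[of A] False A
        by (simp add: subset_term_def monomial_def mult_ac del: of_nat_diff)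
    qed
    then have "subset_sum \<alpha> \<beta> \<gamma> x y z G =
        (\<Sum>A\<in>Pow ?E. if A = {} then \<beta> ^ (?l - 1) * \<gamma> else 0) + (z - \<gamma>) * (\<Sum>A\<in>Pow ?E. ?F A)"
      unfolding subset_sum_def sum_distrib_left sum.distrib[symmetric] by (intro sum.cong) auto
    also have "(\<Sum>A\<in>Pow ?E. if A = {} then \<beta> ^ (?l - 1) * \<gamma> else 0) = \<beta> ^ (?l - 1) * \<gamma>"
      using fE by (simp add: sum.delta)
    also have "(\<Sum>A\<in>Pow ?E. ?F A) = (\<Sum>i<?l. y ^ (?l - 1 - i) * \<beta> ^ i)"
      by (rule sum_nonempty_subsets[OF fE])
    also have "{..<?l} = {0..?l - 1}" using l by auto
    finally show ?thesis using False by simp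
  qed
qed

text \<open>The functions \<open>ends\<close> and \<open>sign\<close> are copied unrestricted, so
  that the disjoint union of complementary parts equals \<open>G\<close> itself and not merely an
  isomorphic graph.\<close>

definition vertex_part :: "'v set \<Rightarrow> ('v, 'e) sgraph \<Rightarrow> ('v, 'e) sgraph" where
  "vertex_part W G = \<lparr>verts = W, edges = {e \<in> edges G. ends G e \<subseteq> W}, ends = ends G, sign = sign G\<rparr>"

lemma vertex_part_simps:
  "verts (vertex_part W G) = W" "edges (vertex_part W G) = {e \<in> edges G. ends G e \<subseteq> W}"
  "ends (vertex_part W G) = ends G" "sign (vertex_part W G) = sign G"
  by (simp_all add: vertex_part_def)

lemma negative_loop_vertex_part:
  "negative_loop_graph G \<Longrightarrow> W \<subseteq> verts G \<Longrightarrow> negative_loop_graph (vertex_part W G)"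
  by (auto simp: vertex_part_simps negative_loop_graph_def signed_graph_def graph_loop_def intro: finite_subset)

lemma negative_loop_split:
  assumes N: "negative_loop_graph G" and W: "W \<subseteq> verts G"
  defines "G1 \<equiv> vertex_part W G" and "G2 \<equiv> vertex_part (verts G - W) G"
  shows "disjoint G1 G2" "disj_union G1 G2 = G" "edges G = edges G1 \<union> edges G2"
proof -
  have ends: "\<exists>w\<in>verts G. ends G e = {w}" if e: "e \<in> edges G" for e
  proof -
    have "signed_graph G" "graph_loop G e" using N e by (auto simp: negative_loop_graph_def)
    then show ?thesis using ends_cases[of G e] e by (metis insert_absorb2)
  qed
  show E: "edges G = edges G1 \<union> edges G2" using ends by (fastforce simp: vertex_part_simps G1_def G2_def)
  show "disjoint G1 G2" using ends by (fastforce simp: vertex_part_simps G1_def G2_def disjoint_def)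
  show "disj_union G1 G2 = G"
    using W by (auto simp: disj_union_def fun_eq_iff E[symmetric] intro!: sgraph.equality)
      (auto simp: G1_def G2_def vertex_part_simps)
qed

text \<open>Subsets of the edges correspond to pairs of subsets of the two parts, and cardinalities
  and ranks add, so each term is a product.\<close>

lemma subset_sum_disj_union:
  fixes \<alpha> \<beta> \<gamma> x y z :: "'k::field"
  assumes N: "negative_loop_graph G" and W: "W \<subseteq> verts G" 
  shows "subset_sum \<alpha> \<beta> \<gamma> x y z G = subset_sum \<alpha> \<beta> \<gamma> x y z (vertex_part W G) *
    subset_sum \<alpha> \<beta> \<gamma> x y z (vertex_part (verts G - W) G)"
proof -
  let ?G1 = "vertex_part W G" and ?G2 = "vertex_part (verts G - W) G"
  let ?E1 = "edges ?G1" and ?E2 = "edges ?G2"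
  have N1: "negative_loop_graph ?G1" "negative_loop_graph ?G2"
    using negative_loop_vertex_part[OF N] W by auto
  have G: "signed_graph G" "signed_graph ?G1" "signed_graph ?G2"
    using N N1 by (auto simp: negative_loop_graph_def)
  have E: "edges G = ?E1 \<union> ?E2" and E0: "?E1 \<inter> ?E2 = {}"
    using negative_loop_split[OF N W] by (auto simp: disjoint_def)
  have fin: "finite ?E1" "finite ?E2" using G(2,3) signed_graph_finite(2) by blast+
  have card: "card (A \<union> B) = card A + card B" if "A \<subseteq> ?E1" "B \<subseteq> ?E2" for A B
    using that fin E0 by (intro card_Un_disjoint) (auto intro: finite_subset)
  have rF: "r\<^sub>F G (A \<union> B) = r\<^sub>F ?G1 A + r\<^sub>F ?G2 B" if AB: "A \<subseteq> ?E1" "B \<subseteq> ?E2" for A B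
  proof -
    have U: "\<Union>(ends G ` A) \<subseteq> W" "\<Union>(ends G ` B) \<subseteq> verts G - W" using AB by (auto simp: vertex_part_simps)
    have "finite (\<Union>(ends G ` A))" "finite (\<Union>(ends G ` B))"
      using U W signed_graph_finite(1)[OF G(1)] by (meson finite_Diff finite_subset)+
    then have "card (\<Union>(ends G ` A) \<union> \<Union>(ends G ` B)) = card (\<Union>(ends G ` A)) + card (\<Union>(ends G ` B))"
      using U by (intro card_Un_disjoint) auto
    moreover have "r\<^sub>F G (A \<union> B) = int (card (\<Union>(ends G ` A) \<union> \<Union>(ends G ` B)))"
      using r\<^sub>F_negative_loops[OF N, of "A \<union> B"] AB E by (auto simp: image_Un)
    ultimately show ?thesis
      using r\<^sub>F_negative_loops[OF N1(1) AB(1)] r\<^sub>F_negative_loops[OF N1(2) AB(2)] by (simp add: vertex_part_simps)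
  qed
  have term_Un: "subset_term \<alpha> \<beta> \<gamma> x y z G (A \<union> B) = subset_term \<alpha> \<beta> \<gamma> x y z ?G1 A * subset_term \<alpha> \<beta> \<gamma> x y z ?G2 B"
    if AB: "A \<subseteq> ?E1" "B \<subseteq> ?E2" for A B
  proof -
    have AB': "A \<union> B \<subseteq> edges G" using AB E by auto
    note nn = subset_exponents_nonneg[OF G(2) AB(1)] subset_exponents_nonneg[OF G(3) AB(2)]
    \<comment> \<open>As all values of \<open>r\<^sub>M\<close> are 0 here, the exponents of
      \<gamma> are these differences. Their being nonnegative lets the power of \<gamma> split for
      every \<gamma>.\<close>
    have rF1: "0 \<le> r\<^sub>F ?G1 ?E1 - r\<^sub>F ?G1 A" "0 \<le> r\<^sub>F ?G2 ?E2 - r\<^sub>F ?G2 B"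
      using r\<^sub>F_bounds[OF G(2) AB(1) order_refl] r\<^sub>F_bounds[OF G(3) AB(2) order_refl] by auto
    have rM: "r\<^sub>M G (A \<union> B) = 0" "r\<^sub>M G (edges G) = 0" "r\<^sub>M ?G1 A = 0" "r\<^sub>M ?G2 B = 0"
      "r\<^sub>M ?G1 ?E1 = 0" "r\<^sub>M ?G2 ?E2 = 0"
      using r\<^sub>M_loops[OF N AB'] r\<^sub>M_loops[OF N order_refl] r\<^sub>M_loops[OF N1(1) AB(1)]
        r\<^sub>M_loops[OF N1(2) AB(2)] r\<^sub>M_loops[OF N1(1) order_refl] r\<^sub>M_loops[OF N1(2) order_refl] by auto
    have cE: "card (edges G) = card ?E1 + card ?E2" "r\<^sub>F G (edges G) = r\<^sub>F ?G1 ?E1 + r\<^sub>F ?G2 ?E2"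
      using card[OF order_refl order_refl] rF[OF order_refl order_refl] E by auto
    have exps: "int (card (edges G)) - int (card (A \<union> B)) + r\<^sub>F G (A \<union> B) - r\<^sub>F G (edges G) =
        (int (card ?E1) - int (card A) + r\<^sub>F ?G1 A - r\<^sub>F ?G1 ?E1) + (int (card ?E2) - int (card B) + r\<^sub>F ?G2 B - r\<^sub>F ?G2 ?E2)"
      "r\<^sub>F G (edges G) - r\<^sub>F G (A \<union> B) - (0 - 0) = (r\<^sub>F ?G1 ?E1 - r\<^sub>F ?G1 A - (0 - 0)) + (r\<^sub>F ?G2 ?E2 - r\<^sub>F ?G2 B - (0 - 0))"
      "int (card (A \<union> B)) - r\<^sub>F G (A \<union> B) = (int (card A) - r\<^sub>F ?G1 A) + (int (card B) - r\<^sub>F ?G2 B)"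
      "r\<^sub>F G (A \<union> B) - 0 = (r\<^sub>F ?G1 A - 0) + (r\<^sub>F ?G2 B - 0)"
      unfolding cE card[OF AB] rF[OF AB] by simp_all
    have p1: "\<beta> powi (int (card (edges G)) - int (card (A \<union> B)) + r\<^sub>F G (A \<union> B) - r\<^sub>F G (edges G)) =
      \<beta> powi (int (card ?E1) - int (card A) + r\<^sub>F ?G1 A - r\<^sub>F ?G1 ?E1) * \<beta> powi (int (card ?E2) - int (card B) + r\<^sub>F ?G2 B - r\<^sub>F ?G2 ?E2)"
      unfolding exps(1) by (rule power_int_add_nonneg[OF nn(2,7)])
    have p2: "\<gamma> powi (r\<^sub>F G (edges G) - r\<^sub>F G (A \<union> B) - (0 - 0)) =
      \<gamma> powi (r\<^sub>F ?G1 ?E1 - r\<^sub>F ?G1 A - (0 - 0)) * \<gamma> powi (r\<^sub>F ?G2 ?E2 - r\<^sub>F ?G2 B - (0 - 0))"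
      unfolding exps(2) by (rule power_int_add_nonneg) (use rF1 in simp_all)
    have p3: "(y - \<beta>) powi (int (card (A \<union> B)) - r\<^sub>F G (A \<union> B)) =
      (y - \<beta>) powi (int (card A) - r\<^sub>F ?G1 A) * (y - \<beta>) powi (int (card B) - r\<^sub>F ?G2 B)"
      unfolding exps(3) by (rule power_int_add_nonneg[OF nn(4,9)])
    have p4: "(z - \<gamma>) powi (r\<^sub>F G (A \<union> B) - 0) = (z - \<gamma>) powi (r\<^sub>F ?G1 A - 0) * (z - \<gamma>) powi (r\<^sub>F ?G2 B - 0)"
      unfolding exps(4) by (rule power_int_add_nonneg) (use nn(5,10) rM in simp_all)
    show ?thesis
      unfolding subset_term_def monomial_def rM p1 p2 p3 p4
      by (simp only: mult_ac diff_self power_int_0_right mult_1_left)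
  qed
  have bij: "bij_betw (\<lambda>(A, B). A \<union> B) (Pow ?E1 \<times> Pow ?E2) (Pow (edges G))"
    by (rule bij_betw_byWitness[where f' = "\<lambda>C. (C \<inter> ?E1, C \<inter> ?E2)"])
      (use E E0 in \<open>auto\<close>)
  have "subset_sum \<alpha> \<beta> \<gamma> x y z G = (\<Sum>(A, B)\<in>Pow ?E1 \<times> Pow ?E2. subset_term \<alpha> \<beta> \<gamma> x y z G (A \<union> B))"
    unfolding subset_sum_def sum.reindex_bij_betw[OF bij, symmetric] by (simp add: case_prod_unfold)
  also have "\<dots> = (\<Sum>(A, B)\<in>Pow ?E1 \<times> Pow ?E2. subset_term \<alpha> \<beta> \<gamma> x y z ?G1 A * subset_term \<alpha> \<beta> \<gamma> x y z ?G2 B)"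
    by (intro sum.cong) (auto simp: term_Un)
  also have "\<dots> = subset_sum \<alpha> \<beta> \<gamma> x y z ?G1 * subset_sum \<alpha> \<beta> \<gamma> x y z ?G2"
    unfolding subset_sum_def sum_product sum.cartesian_product ..
  finally show ?thesis .
qed

section \<open>The scaled Tutte polynomial as a Laurent polynomial\<close>

text \<open>Writing x / a - 1 as (x - a) / a, and likewise for the other two variables, leaves
  denominators that combine with the prefactor to the powers of a, b and g in each term.\<close>

lemma scaled_tutte_subset_sum:
  fixes a b g x y z :: "'k::field"
  assumes G: "signed_graph G" and nz: "a \<noteq> 0" "b \<noteq> 0" "g \<noteq> 0"
  shows "scaled_tutte G a b g x y z = subset_sum a b g x y z G"
proof -
  have "a powi r\<^sub>M G (edges G) * b powi (int (card (edges G)) - r\<^sub>F G (edges G)) *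
     g powi (r\<^sub>F G (edges G) - r\<^sub>M G (edges G)) *
     ((x / a - 1) powi (int (k (spanning G A)) - int (k G)) *
      (y / b - 1) powi (int (card A) - int (card (verts G)) + int (k\<^sub>b (spanning G A))) *
      (z / g - 1) ^ k\<^sub>u (spanning G A)) = subset_term a b g x y z G A"
    if A: "A \<subseteq> edges G" for A
  proof -
    let ?m = "r\<^sub>M G (edges G)" and ?f = "r\<^sub>F G (edges G)" and ?n = "r\<^sub>M G A" and ?h = "r\<^sub>F G A"
    have 1: "int (k (spanning G A)) - int (k G) = ?m - ?n"
      "int (card A) - int (card (verts G)) + int (k\<^sub>b (spanning G A)) = int (card A) - ?h"
      by (simp_all add: r\<^sub>M_def r\<^sub>F_def)
    have 2: "(z / g - 1) ^ k\<^sub>u (spanning G A) = (z / g - 1) powi (?h - ?n)"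
      using k\<^sub>u_spanning[OF G A] by (metis power_int_of_nat)
    have 3: "x / a - 1 = (x - a) / a" "y / b - 1 = (y - b) / b" "z / g - 1 = (z - g) / g"
      using nz by (simp_all add: diff_divide_distrib)
    have "a powi ?n = a powi (?m - (?m - ?n))" by simp
    also have "\<dots> = a powi ?m / a powi (?m - ?n)" using nz by (subst power_int_diff) auto
    finally have a: "a powi ?n = a powi ?m / a powi (?m - ?n)" .
    have "b powi (int (card (edges G)) - int (card A) + ?h - ?f) =
        b powi ((int (card (edges G)) - ?f) - (int (card A) - ?h))" by (simp add: algebra_simps)
    also have "\<dots> = b powi (int (card (edges G)) - ?f) / b powi (int (card A) - ?h)"
      using nz by (subst power_int_diff) auto
    finally have b: "b powi (int (card (edges G)) - int (card A) + ?h - ?f) =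
      b powi (int (card (edges G)) - ?f) / b powi (int (card A) - ?h)" .
    have "g powi (?f - ?h - (?m - ?n)) = g powi ((?f - ?m) - (?h - ?n))" by (simp add: algebra_simps)
    also have "\<dots> = g powi (?f - ?m) / g powi (?h - ?n)" using nz by (subst power_int_diff) auto
    finally have g: "g powi (?f - ?h - (?m - ?n)) = g powi (?f - ?m) / g powi (?h - ?n)" .
    show ?thesis
      unfolding 1 2 unfolding 3 subset_term_def monomial_def a b g power_int_divide_distrib
      by (simp add: field_simps)
  qed
  then show ?thesis
    unfolding scaled_tutte_def signed_tutte_def subset_sum_def sum_distrib_left
    by (intro sum.cong) auto
qed

section \<open>Functions given by one polynomial over the Laurent polynomials\<close>

definition power_product ::
  "'k::field \<Rightarrow> 'k \<Rightarrow> 'k \<Rightarrow> 'k \<Rightarrow> 'k \<Rightarrow> nat \<times> nat \<times> nat \<times> nat \<times> nat \<Rightarrow> 'k" where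
  "power_product a b x y z t = (case t of (i, j, l, m, n) \<Rightarrow> a ^ i * b ^ j * x ^ l * y ^ m * z ^ n)"

lemma poly5_eval_alt:
  "poly5_eval p g a b x y z =
    (\<Sum>t\<in>Poly_Mapping.keys p. laurent_eval (Poly_Mapping.lookup p t) g * power_product a b x y z t)"
  unfolding poly5_eval_def power_product_def by (intro sum.cong) (auto simp: mult.assoc)

text \<open>Allows two Laurent polynomials and their sum, whose support may shrink by cancellation,
  to be evaluated over one index set.\<close>

lemma laurent_eval_superset:
  assumes "finite S" "Poly_Mapping.keys c \<subseteq> S"
  shows "laurent_eval c g = (\<Sum>n\<in>S. of_int (Poly_Mapping.lookup c n) * g powi n)"
  unfolding laurent_eval_def using assms
  by (intro sum.mono_neutral_left) (auto simp: in_keys_iff)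

lemma laurent_eval_0 [simp]: "laurent_eval 0 g = 0"
  by (simp add: laurent_eval_def)

lemma laurent_eval_add: "laurent_eval (c + d) g = laurent_eval c g + laurent_eval d g"
proof -
  let ?S = "Poly_Mapping.keys c \<union> Poly_Mapping.keys d"
  have "Poly_Mapping.keys (c + d) \<subseteq> ?S" by (rule Poly_Mapping.keys_add)
  then show ?thesis
    using laurent_eval_superset[of ?S c g] laurent_eval_superset[of ?S d g]
      laurent_eval_superset[of ?S "c + d" g]
    by (simp add: lookup_add algebra_simps sum.distrib)
qed

lemma poly5_eval_superset:
  assumes "finite S" "Poly_Mapping.keys p \<subseteq> S"
  shows "poly5_eval p g a b x y z =
    (\<Sum>t\<in>S. laurent_eval (Poly_Mapping.lookup p t) g * power_product a b x y z t)"
  unfolding poly5_eval_alt using assms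
  by (intro sum.mono_neutral_left) (auto simp: in_keys_iff)

lemma poly5_eval_add: "poly5_eval (p + q) g a b x y z = poly5_eval p g a b x y z + poly5_eval q g a b x y z"
proof -
  let ?S = "Poly_Mapping.keys p \<union> Poly_Mapping.keys q"
  have "Poly_Mapping.keys (p + q) \<subseteq> ?S" by (rule Poly_Mapping.keys_add)
  then show ?thesis
    using poly5_eval_superset[of ?S p g a b x y z] poly5_eval_superset[of ?S q g a b x y z]
      poly5_eval_superset[of ?S "p + q" g a b x y z]
    by (simp add: lookup_add laurent_eval_add algebra_simps sum.distrib)
qed

text \<open>The polynomial is chosen before the arguments, so a single one serves all values. The
  restriction to nonzero g makes the exponents of g add under multiplication.\<close>

definition poly_fun :: "('k::field \<Rightarrow> 'k \<Rightarrow> 'k \<Rightarrow> 'k \<Rightarrow> 'k \<Rightarrow> 'k \<Rightarrow> 'k) \<Rightarrow> bool" where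
  "poly_fun F \<longleftrightarrow> (\<exists>p. \<forall>g a b x y z. g \<noteq> 0 \<longrightarrow> F g a b x y z = poly5_eval p g a b x y z)"

lemma poly_fun_add:
  "poly_fun F \<Longrightarrow> poly_fun H \<Longrightarrow> poly_fun (\<lambda>g a b x y z. F g a b x y z + H g a b x y z)"
  unfolding poly_fun_def by (metis poly5_eval_add)

lemma poly_fun_0: "poly_fun (\<lambda>g a b x y z. 0)"
  unfolding poly_fun_def by (rule exI[of _ 0]) (simp add: poly5_eval_def)

lemma poly_fun_sum:
  "(\<And>i. i \<in> I \<Longrightarrow> poly_fun (F i)) \<Longrightarrow> poly_fun (\<lambda>g a b x y z. \<Sum>i\<in>I. F i g a b x y z)"
  by (induction I rule: infinite_finite_induct) (auto intro: poly_fun_0 poly_fun_add)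

lemma poly_fun_monomial: "poly_fun (\<lambda>g a b x y z. of_int c * g powi n * power_product a b x y z t)"
proof -
  have "Poly_Mapping.single n c = 0 \<longleftrightarrow> c = 0" by (metis lookup_single_eq lookup_zero single_zero)
  then show ?thesis
    unfolding poly_fun_def
    by (intro exI[of _ "Poly_Mapping.single t (Poly_Mapping.single n c)"])
      (auto simp: poly5_eval_alt laurent_eval_def)
qed

lemma poly5_eval_expand:
  "poly5_eval p g a b x y z = (\<Sum>t\<in>Poly_Mapping.keys p. \<Sum>n\<in>Poly_Mapping.keys (Poly_Mapping.lookup p t).
     of_int (Poly_Mapping.lookup (Poly_Mapping.lookup p t) n) * g powi n * power_product a b x y z t)"
  by (simp add: poly5_eval_alt laurent_eval_def sum_distrib_right)

lemma power_product_mult: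
  obtains u where "\<And>a b x y z :: 'k::field.
    power_product a b x y z s * power_product a b x y z t = power_product a b x y z u"
proof -
  obtain i j l m n i' j' l' m' n' where st: "s = (i, j, l, m, n)" "t = (i', j', l', m', n')"
    by (metis prod.exhaust)
  show ?thesis
    by (rule that[of "(i + i', j + j', l + l', m + m', n + n')"])
      (simp add: st power_product_def power_add)
qed

text \<open>Expanding both factors into monomials reduces the product to sums of products of two
  monomials, so closure under addition suffices and no product of coefficient mappings has to be
  evaluated.\<close>

lemma poly_fun_mult:
  assumes "poly_fun F" "poly_fun H"
  shows "poly_fun (\<lambda>g a b x y z. F g a b x y z * H g a b x y z :: 'k::field)"
proof -
  obtain p q where p: "\<And>g a b x y z. g \<noteq> 0 \<Longrightarrow> F g a b x y z = poly5_eval p g a b x y z"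
    and q: "\<And>g a b x y z. g \<noteq> 0 \<Longrightarrow> H g a b x y z = poly5_eval q g a b x y z"
    using assms unfolding poly_fun_def by metis
  have cong: "poly_fun K" if "poly_fun K'" "\<And>g a b x y z. g \<noteq> 0 \<Longrightarrow> K g a b x y z = K' g a b x y z"
    for K K' :: "'k \<Rightarrow> 'k \<Rightarrow> 'k \<Rightarrow> 'k \<Rightarrow> 'k \<Rightarrow> 'k \<Rightarrow> 'k"
    using that unfolding poly_fun_def by metis
  have mono: "poly_fun (\<lambda>g a b x y z :: 'k. (of_int c * g powi n * power_product a b x y z t) *
      (of_int c' * g powi n' * power_product a b x y z t'))" for c n t c' n' t'
  proof -
    obtain u where u: "\<And>a b x y z :: 'k.
        power_product a b x y z t * power_product a b x y z t' = power_product a b x y z u"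
      using power_product_mult by blast
    show ?thesis
      by (rule cong[OF poly_fun_monomial[of "c * c'" "n + n'" u]])
        (simp add: power_int_add mult_ac flip: u)
  qed
  have "poly_fun (\<lambda>g a b x y z :: 'k. poly5_eval p g a b x y z * poly5_eval q g a b x y z)"
    unfolding poly5_eval_expand sum_distrib_right sum_distrib_left
    by (intro poly_fun_sum mono)
  then show ?thesis by (rule cong) (simp add: p q)
qed

lemma poly_fun_power: "poly_fun F \<Longrightarrow> poly_fun (\<lambda>g a b x y z. F g a b x y z ^ n)"
proof (induction n)
  case 0
  show ?case using poly_fun_monomial[of 1 0 "(0, 0, 0, 0, 0)"] by (simp add: power_product_def)
next
  case (Suc n) then show ?case using poly_fun_mult by simp
qed

lemma poly_fun_vars:
  "poly_fun (\<lambda>g a b x y z. a)" "poly_fun (\<lambda>g a b x y z. b)" "poly_fun (\<lambda>g a b x y z. g powi n)"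
  "poly_fun (\<lambda>g a b x y z. x - a)" "poly_fun (\<lambda>g a b x y z. y - b)" "poly_fun (\<lambda>g a b x y z. z - g)"
proof -
  show a: "poly_fun (\<lambda>g a b x y z. a)" and b: "poly_fun (\<lambda>g a b x y z. b)"
    and g: "poly_fun (\<lambda>g a b x y z. g powi n)" for n
    using poly_fun_monomial[of 1 0 "(1, 0, 0, 0, 0)"] poly_fun_monomial[of 1 0 "(0, 1, 0, 0, 0)"]
      poly_fun_monomial[of 1 n "(0, 0, 0, 0, 0)"] by (simp_all add: power_product_def)
  show "poly_fun (\<lambda>g a b x y z. x - a)"
    using poly_fun_add[OF poly_fun_monomial[of 1 0 "(0, 0, 1, 0, 0)"] poly_fun_monomial[of "- 1" 0 "(1, 0, 0, 0, 0)"]]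
    by (simp add: power_product_def)
  show "poly_fun (\<lambda>g a b x y z. y - b)"
    using poly_fun_add[OF poly_fun_monomial[of 1 0 "(0, 0, 0, 1, 0)"] poly_fun_monomial[of "- 1" 0 "(0, 1, 0, 0, 0)"]]
    by (simp add: power_product_def)
  show "poly_fun (\<lambda>g a b x y z. z - g)"
    using poly_fun_add[OF poly_fun_monomial[of 1 0 "(0, 0, 0, 0, 1)"] poly_fun_monomial[of "- 1" 1 "(0, 0, 0, 0, 0)"]]
    by (simp add: power_product_def)
qed

text \<open>Five exponents are nonnegative and become ordinary powers; the power of g remains an
  integer power and belongs to the Laurent coefficients.\<close>

lemma poly_fun_subset_sum:
  assumes G: "signed_graph G"
  shows "poly_fun (\<lambda>g a b x y z :: 'k::field. subset_sum a b g x y z G)"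
proof -
  have "poly_fun (\<lambda>g a b x y z :: 'k. subset_term a b g x y z G A)" if A: "A \<in> Pow (edges G)" for A
  proof -
    have *: "c powi n = c ^ nat n" if "0 \<le> n" for c :: 'k and n using that by (simp add: power_int_def)
    have A': "A \<subseteq> edges G" using A by simp
    note nn = subset_exponents_nonneg[OF G A']
    show ?thesis
      unfolding subset_term_def monomial_def nn[THEN *]
      by (intro poly_fun_mult poly_fun_power poly_fun_vars)
  qed
  then show ?thesis unfolding subset_sum_def by (rule poly_fun_sum)
qed

section \<open>The recipe theorem\<close>

theorem theorem4p3:
  fixes R :: "('v::infinite, 'e::infinite) sgraph \<Rightarrow> 'k::field"
    and \<alpha> \<beta> \<gamma> x y z :: 'k
  assumes invariant: "\<And>G H. signed_graph G \<Longrightarrow> signed_graph H \<Longrightarrow> isomorphic G H \<Longrightarrow> R G = R H"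
    and switching: "\<And>G v. signed_graph G \<Longrightarrow> v \<in> verts G \<Longrightarrow> R (switch v G) = R G"
    and multiplicative: "\<And>G H. signed_graph G \<Longrightarrow> signed_graph H \<Longrightarrow> disjoint G H \<Longrightarrow>
          R (disj_union G H) = R G * R H"
    and gamma: "\<gamma> \<noteq> 0"
    and ordinary: "\<And>G e. signed_graph G \<Longrightarrow> e \<in> edges G \<Longrightarrow> sign G e = 1 \<Longrightarrow>
          matroid_ordinary (edges G) (r\<^sub>M G) e \<Longrightarrow> matroid_ordinary (edges G) (r\<^sub>F G) e \<Longrightarrow>
          R G = \<alpha> * R (contract G e) + \<beta> * R (delete G e)"
    and ordinary_unbalancing: "\<And>G e. signed_graph G \<Longrightarrow> e \<in> edges G \<Longrightarrow> sign G e = 1 \<Longrightarrow>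
          matroid_ordinary (edges G) (r\<^sub>M G) e \<Longrightarrow> k\<^sub>u (delete G e) < k\<^sub>u G \<Longrightarrow>
          R G = \<alpha> * R (contract G e) + \<gamma> * R (delete G e)"
    and bridge_circuit_path: "\<And>G e. signed_graph G \<Longrightarrow> e \<in> edges G \<Longrightarrow> sign G e = 1 \<Longrightarrow>
          bridge G e \<Longrightarrow> circuit_path_edge G e \<Longrightarrow>
          R G = \<alpha> * R (contract G e) + \<beta> * (x - \<alpha>) / \<gamma> * R (delete G e)"
    and bridge_not_circuit_path: "\<And>G e. signed_graph G \<Longrightarrow> e \<in> edges G \<Longrightarrow> sign G e = 1 \<Longrightarrow>
          bridge G e \<Longrightarrow> \<not> circuit_path_edge G e \<Longrightarrow>
          R G = x * R (contract G e)"
    and loop: "\<And>G e. signed_graph G \<Longrightarrow> e \<in> edges G \<Longrightarrow> sign G e = 1 \<Longrightarrow>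
          matroid_loop (r\<^sub>M G) e \<Longrightarrow> matroid_loop (r\<^sub>F G) e \<Longrightarrow>
          R G = y * R (delete G e)"
    and negative_loops: "\<And>G v l. signed_graph G \<Longrightarrow> verts G = {v} \<Longrightarrow>
          (\<forall>e\<in>edges G. sign G e = -1) \<Longrightarrow> card (edges G) = l \<Longrightarrow> l \<ge> 1 \<Longrightarrow>
          R G = \<beta> ^ (l - 1) * \<gamma> + (z - \<gamma>) * (\<Sum>i=0..l-1. y ^ (l - 1 - i) * \<beta> ^ i)"
    and single_vertex: "\<And>G v. signed_graph G \<Longrightarrow> verts G = {v} \<Longrightarrow> edges G = {} \<Longrightarrow> R G = 1"
  shows "\<forall>G. signed_graph G \<longrightarrow>
     (\<alpha> \<noteq> 0 \<longrightarrow> \<beta> \<noteq> 0 \<longrightarrow> R G = scaled_tutte G \<alpha> \<beta> \<gamma> x y z) \<and>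
     (\<exists>p. (\<forall>a b g x' y' z'. a \<noteq> 0 \<longrightarrow> b \<noteq> 0 \<longrightarrow> g \<noteq> (0::'k) \<longrightarrow>
             scaled_tutte G a b g x' y' z' = poly5_eval p g a b x' y' z') \<and>
          R G = poly5_eval p \<gamma> \<alpha> \<beta> x y z) \<and>
     R G = (\<Sum>A\<in>Pow (edges G).
       \<alpha> powi r\<^sub>M G A *
       \<beta> powi (int (card (edges G)) - int (card A) + r\<^sub>F G A - r\<^sub>F G (edges G)) *
       \<gamma> powi (r\<^sub>F G (edges G) - r\<^sub>F G A - (r\<^sub>M G (edges G) - r\<^sub>M G A)) *
       (x - \<alpha>) powi (r\<^sub>M G (edges G) - r\<^sub>M G A) *
       (y - \<beta>) powi (int (card A) - r\<^sub>F G A) *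
       (z - \<gamma>) powi (r\<^sub>F G A - r\<^sub>M G A))"
proof -
  let ?S = "subset_sum \<alpha> \<beta> \<gamma> x y z :: ('v, 'e) sgraph \<Rightarrow> 'k"
  \<comment> \<open>The recurrences give no value for the graph without vertices. Adding an isolated
    vertex multiplies \<open>R\<close> by 1 and yields a single vertex again, which forces the value
    1.\<close>
  have empty: "R G = 1" if G: "signed_graph G" "verts G = {}" for G
  proof -
    have E: "edges G = {}"
    proof (rule ccontr)
      assume "edges G \<noteq> {}"
      then obtain e where "e \<in> edges G" by blast
      then show False using ends_cases[OF G(1)] G(2) by blast
    qed
    obtain v :: 'v where True by simp
    let ?P = "\<lparr>verts = {v}, edges = {}, ends = ends G, sign = sign G\<rparr>"
    have P: "signed_graph ?P" by (simp add: signed_graph_def)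
    have "disjoint G ?P" using G E by (simp add: disjoint_def)
    then have "R (disj_union G ?P) = R G * R ?P" by (rule multiplicative[OF G(1) P])
    moreover have "signed_graph (disj_union G ?P)" "verts (disj_union G ?P) = {v}" "edges (disj_union G ?P) = {}"
      using G E by (auto simp: disj_union_def signed_graph_def)
    then have "R (disj_union G ?P) = 1" by (rule single_vertex)
    moreover have "R ?P = 1" by (rule single_vertex[OF P]) auto
    ultimately show ?thesis by simp
  qed
  have negative: "R G = ?S G" if "negative_loop_graph G" for G
    using that
  proof (induction "card (verts G)" arbitrary: G)
    case 0
    then have G: "signed_graph G" "verts G = {}"
      using signed_graph_finite(1)[of G] by (auto simp: negative_loop_graph_def)
    then have "edges G = {}" using ends_cases[OF G(1)] by blast
    then show ?case using empty[OF G] r\<^sub>F_empty[OF G(1)] r\<^sub>M_empty[OF G(1)]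
      by (simp add: subset_sum_def subset_term_def monomial_def)
  next
    case (Suc n)
    then obtain v where v: "v \<in> verts G" by fastforce
    let ?G1 = "vertex_part {v} G" and ?G2 = "vertex_part (verts G - {v}) G"
    have N: "negative_loop_graph ?G1" "negative_loop_graph ?G2"
      using negative_loop_vertex_part[OF Suc.prems] v by auto
    then have G: "signed_graph ?G1" "signed_graph ?G2" by (auto simp: negative_loop_graph_def)
    have v1: "verts ?G1 = {v}" by (simp add: vertex_part_simps)
    have "R ?G1 = ?S ?G1"
    proof (cases "edges ?G1 = {}")
      case True
      then show ?thesis
        using subset_sum_single_vertex[OF N(1) v1, of \<alpha> \<beta> \<gamma> x y z] single_vertex[OF G(1) v1] by simp
    next
      case False
      then have "card (edges ?G1) \<ge> 1" using signed_graph_finite(2)[OF G(1)]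
        by (simp add: Suc_le_eq card_gt_0_iff)
      moreover have "\<forall>e\<in>edges ?G1. sign ?G1 e = - 1" using N(1) by (simp add: negative_loop_graph_def)
      ultimately show ?thesis
        using subset_sum_single_vertex[OF N(1) v1, of \<alpha> \<beta> \<gamma> x y z] negative_loops[OF G(1) v1 _ refl] False
        by simp
    qed
    moreover have "R ?G2 = ?S ?G2"
      by (rule Suc.hyps(1)[OF _ N(2)]) (use Suc.hyps(2) v in \<open>simp add: vertex_part_simps\<close>)
    moreover have "R G = R ?G1 * R ?G2"
      using negative_loop_split[OF Suc.prems, of "{v}"] multiplicative[OF G] v by simp
    ultimately show ?case
      using subset_sum_disj_union[OF Suc.prems, of "{v}" \<alpha> \<beta> \<gamma> x y z] v by simp
  qed
  have main: "R G = ?S G" if "signed_graph G" for G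
    using that
  proof (induction "card (edges G)" arbitrary: G rule: less_induct)
    case less
    note G = less.prems
    have smaller: "card (edges G - {e}) < card (edges G)" if "e \<in> edges G" for e
      using card_edges_delete[OF G that] by simp
    \<comment> \<open>Stated for an arbitrary graph with the same number of edges, so that it also
      covers a graph obtained from \<open>G\<close> by switching.\<close>
    have positive: "R G' = ?S G'" if G': "signed_graph G'" and E: "card (edges G') = card (edges G)"
      and e: "e \<in> edges G'" "\<not> graph_loop G' e" "sign G' e = 1" for G' e
    proof -
      let ?E = "edges G'"
      have smaller': "card (?E - {e}) < card (edges G)" using card_edges_delete[OF G' e(1)] E by simp
      have IH: "R (contract G' e) = ?S (contract G' e)" "R (delete G' e) = ?S (delete G' e)"
        using less.hyps[OF _ signed_graph_contract[OF G' e(1,2)]] less.hyps[OF _ signed_graph_delete[OF G']]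
          smaller' e by (auto simp: contract_simps)
      have eE: "insert e (?E - {e}) = ?E" using e by auto
      have rM: "r\<^sub>M G' ?E = r\<^sub>M G' (?E - {e}) \<or> r\<^sub>M G' ?E = r\<^sub>M G' (?E - {e}) + 1"
        using r\<^sub>M_insert_cases[OF G' _ e(1), of "?E - {e}"] eE by auto
      have rF: "r\<^sub>F G' ?E = r\<^sub>F G' (?E - {e}) \<or> r\<^sub>F G' ?E = r\<^sub>F G' (?E - {e}) + 1"
        using r\<^sub>F_insert_cases[OF G' _ e(1), of "?E - {e}"] eE by auto
      \<comment> \<open>A non-loop has rank 1 in both matroids, so being ordinary reduces to the
        rank not dropping on deletion.\<close>
      have ordM: "matroid_ordinary ?E (r\<^sub>M G') e \<longleftrightarrow> r\<^sub>M G' ?E = r\<^sub>M G' (?E - {e})"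
        using rM r\<^sub>M_nonloop[OF G' e(1,2)]
        unfolding matroid_ordinary_def matroid_loop_def matroid_coloop_def by (elim disjE) simp_all
      have ordF: "matroid_ordinary ?E (r\<^sub>F G') e \<longleftrightarrow> r\<^sub>F G' ?E = r\<^sub>F G' (?E - {e})"
        using rF r\<^sub>F_nonloop[OF G' e(1,2)]
        unfolding matroid_ordinary_def matroid_loop_def matroid_coloop_def by (elim disjE) simp_all
      note rec = subset_sum_delete_contract[OF G' e gamma]
      show ?thesis
      proof (cases "r\<^sub>M G' ?E = r\<^sub>M G' (?E - {e})")
        case M: True
        show ?thesis
        proof (cases "r\<^sub>F G' ?E = r\<^sub>F G' (?E - {e})")
          case True
          then show ?thesis
            using ordinary[OF G' e(1,3)] ordM ordF M IH rec[of 0 0 \<alpha> \<beta> x y z] by simp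
        next
          case False
          then have F: "r\<^sub>F G' ?E = r\<^sub>F G' (?E - {e}) + 1" using rF by blast
          \<comment> \<open>The number of unbalanced components is
            \<open>r\<^sub>F - r\<^sub>M\<close>, and deleting \<open>e\<close> lowers only
            \<open>r\<^sub>F\<close>.\<close>
          have "k\<^sub>u (delete G' e) < k\<^sub>u G'"
            using k\<^sub>u_spanning[OF G', of "?E - {e}"] k\<^sub>u_spanning[OF G', of ?E] M F by (simp add: delete_def)
          then show ?thesis
            using ordinary_unbalancing[OF G' e(1,3)] ordM ordF M F IH rec[of 0 1 \<alpha> \<beta> x y z] by simp
        qed
      next
        case False
        then have M: "r\<^sub>M G' ?E = r\<^sub>M G' (?E - {e}) + 1" using rM by blast
        then have b: "bridge G' e" using bridge_iff_rank[OF G' e(1,2)] by simp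
        show ?thesis
        proof (cases "r\<^sub>F G' ?E = r\<^sub>F G' (?E - {e})")
          case True
          then have "circuit_path_edge G' e" using bridge_rank_circuit_path_edge[OF G' b] by simp
          then show ?thesis
            using bridge_circuit_path[OF G' e(1,3) b] M True IH rec[of 1 0 \<alpha> \<beta> x y z]
            by (simp add: power_int_minus divide_inverse mult_ac)
        next
          case False
          then have F: "r\<^sub>F G' ?E = r\<^sub>F G' (?E - {e}) + 1" using rF by blast
          have "\<not> circuit_path_edge G' e" using circuit_path_edge_rank[OF G' e(1,2)] False by blast
          then show ?thesis
            using bridge_not_circuit_path[OF G' e(1,3) b] IH subset_sum_bridge[OF G' e gamma M F] by simp
        qed
      qed
    qed
    consider e where "e \<in> edges G" "\<not> graph_loop G e"
      | e where "e \<in> edges G" "graph_loop G e" "sign G e = 1"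
      | "negative_loop_graph G"
      using sign_cases[OF G] G unfolding negative_loop_graph_def by blast
    then show ?case
    proof cases
      case (1 e)
      show ?thesis
      proof (cases "sign G e = 1")
        case True then show ?thesis using positive[OF G refl 1] by simp
      next
        case False
        then have neg: "sign G e = - 1" using sign_cases[OF G 1(1)] by blast
        obtain u v where uv: "ends G e = {u, v}" "u \<in> verts G" using ends_cases[OF G 1(1)] by metis
        \<comment> \<open>Switching at one end makes the negative non-loop \<open>e\<close> positive
          and keeps the number of edges.\<close>
        have "R (switch u G) = ?S (switch u G)"
          by (rule positive[OF signed_graph_switch[OF G], of u e]) (use 1 neg uv in \<open>auto simp: switch_def graph_loop_def\<close>)
        then show ?thesis using switching[OF G uv(2)] subset_sum_switch[OF G] by simp
      qed
    next
      case (2 e)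
      have "matroid_loop (r\<^sub>M G) e" "matroid_loop (r\<^sub>F G) e"
        using r\<^sub>M_loop[OF G _ 2(1,2), of "{}"] r\<^sub>F_positive_loop[OF G _ 2, of "{}"] r\<^sub>M_empty[OF G] r\<^sub>F_empty[OF G]
        by (auto simp: matroid_loop_def)
      then have "R G = y * R (delete G e)" by (rule loop[OF G 2(1,3)])
      moreover have "R (delete G e) = ?S (delete G e)"
        by (rule less.hyps[OF _ signed_graph_delete[OF G]]) (use smaller 2 in simp)
      ultimately show ?thesis using subset_sum_positive_loop[OF G 2 gamma] by simp
    next
      case 3 then show ?thesis by (rule negative)
    qed
  qed
  show ?thesis
  proof (intro allI impI conjI)
    fix G :: "('v, 'e) sgraph" assume G: "signed_graph G"
    show "R G = scaled_tutte G \<alpha> \<beta> \<gamma> x y z" if "\<alpha> \<noteq> 0" "\<beta> \<noteq> 0"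
      using main[OF G] scaled_tutte_subset_sum[OF G that gamma] by simp
    obtain p where p: "\<And>g a b x y z :: 'k. g \<noteq> 0 \<Longrightarrow> subset_sum a b g x y z G = poly5_eval p g a b x y z"
      using poly_fun_subset_sum[OF G, where ?'k = 'k] unfolding poly_fun_def by blast
    show "\<exists>p. (\<forall>a b g x' y' z'. a \<noteq> 0 \<longrightarrow> b \<noteq> 0 \<longrightarrow> g \<noteq> (0::'k) \<longrightarrow>
             scaled_tutte G a b g x' y' z' = poly5_eval p g a b x' y' z') \<and>
          R G = poly5_eval p \<gamma> \<alpha> \<beta> x y z"
      by (intro exI[of _ p] conjI allI impI)
        (simp_all add: scaled_tutte_subset_sum[OF G] main[OF G] p gamma)
  qed (simp add: main subset_sum_def subset_term_def monomial_def)
qed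

end
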